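(* Let $\mathcal{T}$ be a generalised triangulation containing a normal surface $S$. Let $\mathcal{C}$ be the cell decomposition obtained by non-destructively crushing $S$ (steps 1 and 2 of the Jaco-Rubinstein crushing procedure), and let $\mathcal{T}_{\mathrm{JR}}$ be the final triangulation obtained at the end of the destructive crushing procedure, after flattening away all non-tetrahedron cells (step 3). Then $\mathcal{T}_{\mathrm{JR}}$ can be obtained from $\mathcal{C}$ by a sequence of zero or more of the following atomic operations, performed one at a time, in some order: (a) flattening a triangular pillow to a triangular face; (b) flattening a bigonal pillow to a bigon face; (c) flattening a bigon face to an edge. After each atomic operation, any 2-faces, edges or vertices that do not belong to a 3-cell are removed, and any pieces of the cell decomposition that are connected only along pinched edges or vertices are pulled apart.
   Context: **Triangulations.** A generalised triangulation is a finite collection of abstract tetrahedra, some or all of whose triangular faces are affinely identified (glued) in pairs; two faces of the same tetrahedron may be identified. The underlying space need not be a 3-manifold: no assumption is made on orientability or vertex links, and edges may be identified with themselves in reverse. A normal surface $S$ in $\mathcal{T}$ is a properly embedded surface meeting each tetrahedron in a (possibly empty) finite collection of disjoint curvilinear triangles (each separating one vertex of the tetrahedron from the other three) and quadrilaterals (each separating two vertices from the other two). **Cell decompositions.** A cell decomposition is a collection of abstract 3-cells (topological 3-balls whose boundaries are decomposed into curvilinear polygonal 2-faces, with bigons allowed, each edge carrying an affine structure), some or all of whose 2-faces are glued in pairs by homeomorphisms that map vertices to vertices and edges to edges and are affine on edges; two 2-faces of the same 3-cell may be glued. Triangulations and cell decompositions are defined entirely by their 3-cells and the pairwise gluings of 2-faces.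 So whenever an operation leaves a 2-face, edge or vertex not belonging to any 3-cell, it is removed (entire components may vanish), and pieces joined only along edges or vertices fall apart. **Jaco-Rubinstein crushing procedure** on a normal surface $S$ in $\mathcal{T}$: 1. Cut $\mathcal{T}$ open along $S$. If $S$ is two-sided this gives two new copies of $S$ on the boundary; if $S$ is one-sided it gives one copy of the double cover of $S$ on the boundary. 2. Collapse each copy of $S$ (or its double cover) on the boundary to a point, using the quotient topology. This gives a cell decomposition $\mathcal{C}$ with cells of the following types. *3-sided footballs* (two vertices, three edges joining them, three bigon faces) come from regions between two parallel triangles of $S$, or between a triangle of $S$ and a tetrahedron vertex. *4-sided footballs* (two vertices, four edges joining them, four bigon faces) come from regions between two parallel quadrilaterals of $S$. *Triangular purses* come from regions between a quadrilateral of $S$ and nearby triangles or tetrahedron vertices; a triangular purse has three vertices $a,b,q$, one edge $ab$, two edges $aq$, two edges $bq$, two triangular faces, and two bigon faces, one bounded by the two edges $aq$ and one by the two edges $bq$. *Tetrahedra* come from the central regions of tetrahedra of $\mathcal{T}$ containing no quadrilateral of $S$. 3. Simultaneously flatten all footballs to edges (all edges of the football become one edge) and all triangular purses to triangular faces (each bigon becomes an edge and the two triangles become one), using the quotient topology. Then read off the generalised triangulation $\mathcal{T}_{\mathrm{JR}}$ defined only by the surviving tetrahedra and the resulting identifications between their 2-faces. Steps 1 and 2 are called non-destructive crushing; steps 1 to 3 are called destructive crushing. **Atomic operations.** A *triangular pillow* is a 3-cell bounded by two triangular faces sharing the same three boundary edges; flattening it collapses it to a single triangle, identifying its two faces (with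 the common boundary edges fixed). A *bigonal pillow* is a 3-cell bounded by two bigon faces sharing the same two boundary edges; flattening it collapses it to a single bigon, identifying its two faces. Flattening a bigon face (a 2-face of the cell decomposition, internal or boundary) to an edge collapses the bigon so that its two boundary edges become a single edge, with the endpoints kept in place; the cells containing that bigon lose the corresponding bigon face, and any gluing across it is lost. *)

theory Defs
  imports Main "HOL-Combinatorics.Permutations"
begin

text \<open>
  A cell decomposition is given by its 3-cells and the pairwise gluings of their 2-faces, and is
  encoded by its flags (a three-dimensional generalised map).  A flag is a nested tuple consisting
  of a 3-cell, a 2-face of that cell, an edge of that 2-face and an endpoint of that edge.
  \<^item> \<open>vertex_sw\<close>, \<open>edge_sw\<close>, \<open>face_sw\<close> send a flag to the unique flag of the \<^emph>\<open>same\<close> 3-cell that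
    differs from it in the vertex, the edge, the 2-face only.  Thus an \<open>n\<close>-gon has \<open>2 * n\<close> flags.
  \<^item> \<open>glue\<close> sends a flag to the flag matched with it by the gluing of its 2-face, and fixes the
    flags of boundary (unglued) 2-faces.  Since gluings are affine on edges, they are
    determined by their effect on flags.

  Faces, edges and vertices exist here only as parts of 3-cells.  Hence 2-faces, edges and vertices
  belonging to no 3-cell disappear, and pieces meeting only along edges or vertices fall
  apart, without any further provision.

  Off the set of flags all four maps are the identity (via \<open>permutes\<close>), so that two decompositions
  on the same flags with the same structure are equal as records.
\<close>

record 'f cell_decomp =
  flags :: "'f set"
  vertex_sw :: "'f \<Rightarrow> 'f"
  edge_sw :: "'f \<Rightarrow> 'f"
  face_sw :: "'f \<Rightarrow> 'f"
  glue :: "'f \<Rightarrow> 'f"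

definition flag_orbit :: "('f \<Rightarrow> 'f) set \<Rightarrow> 'f \<Rightarrow> 'f set" where
  "flag_orbit A x = {y. (x, y) \<in> {(u, h u) | u h. h \<in> A}\<^sup>*}"

definition cell_of :: "('f, 'm) cell_decomp_scheme \<Rightarrow> 'f \<Rightarrow> 'f set" where
  "cell_of D = flag_orbit {vertex_sw D, edge_sw D, face_sw D}"

text \<open>The 2-face, edge and vertex of a flag, as parts of the boundary sphere of its 3-cell
  (before any gluing).\<close>

definition face_of :: "('f, 'm) cell_decomp_scheme \<Rightarrow> 'f \<Rightarrow> 'f set" where
  "face_of D = flag_orbit {vertex_sw D, edge_sw D}"

definition edge_of :: "('f, 'm) cell_decomp_scheme \<Rightarrow> 'f \<Rightarrow> 'f set" where
  "edge_of D = flag_orbit {vertex_sw D, face_sw D}"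

definition vertex_of :: "('f, 'm) cell_decomp_scheme \<Rightarrow> 'f \<Rightarrow> 'f set" where
  "vertex_of D = flag_orbit {edge_sw D, face_sw D}"

text \<open>
  Every 2-face is a polygon with at least two sides, embedded in the boundary of its cell (its edges
  and its corners are pairwise distinct there).  The boundary of every 3-cell is a sphere, expressed
  by Euler characteristic 2; it is connected because cells are orbits.  No 2-face is glued to itself,
  but two 2-faces of one cell may be glued.
\<close>

definition cell_decomposition :: "'f cell_decomp \<Rightarrow> bool" where
  "cell_decomposition D \<longleftrightarrow>
     finite (flags D) \<and>
     (\<forall>h \<in> {vertex_sw D, edge_sw D, face_sw D, glue D}.
        h permutes flags D \<and> (\<forall>x. h (h x) = x)) \<and>
     (\<forall>x \<in> flags D.
        vertex_sw D x \<noteq> x \<and> edge_sw D x \<noteq> x \<and> vertex_sw D x \<noteq> edge_sw D x \<and>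
        vertex_sw D (face_sw D x) = face_sw D (vertex_sw D x) \<and>
        face_sw D x \<notin> face_of D x \<and>
        vertex_of D x \<inter> face_of D x \<subseteq> {x, edge_sw D x} \<and>
        card (vertex_of D ` cell_of D x) + card (face_of D ` cell_of D x)
          = card (edge_of D ` cell_of D x) + 2 \<and>
        glue D (vertex_sw D x) = vertex_sw D (glue D x) \<and>
        glue D (edge_sw D x) = edge_sw D (glue D x) \<and>
        (glue D x \<noteq> x \<longrightarrow> glue D x \<notin> face_of D x))"

text \<open>
  The flags of the standard tetrahedron on the vertices 0, 1, 2, 3 correspond to the orderings
  \<open>p 0, p 1, p 2, p 3\<close> of its vertices: the vertex is \<open>p 0\<close>, the edge joins
  \<open>p 0\<close> and \<open>p 1\<close>, and the face is spanned by \<open>p 0\<close>, \<open>p 1\<close>, \<open>p 2\<close>.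
\<close>

definition tetrahedron :: "'f cell_decomp \<Rightarrow> 'f \<Rightarrow> bool" where
  "tetrahedron D x \<longleftrightarrow>
     (\<exists>\<phi>. bij_betw \<phi> {p. p permutes {..<4::nat}} (cell_of D x) \<and>
        (\<forall>p. p permutes {..<4} \<longrightarrow>
           vertex_sw D (\<phi> p) = \<phi> (p \<circ> transpose 0 1) \<and>
           edge_sw D (\<phi> p) = \<phi> (p \<circ> transpose 1 2) \<and>
           face_sw D (\<phi> p) = \<phi> (p \<circ> transpose 2 3)))"

definition generalised_triangulation :: "'f cell_decomp \<Rightarrow> bool" where
  "generalised_triangulation T \<longleftrightarrow>
     cell_decomposition T \<and> (\<forall>x \<in> flags T. tetrahedron T x)"


text \<open>
  A normal surface is given, as usual up to normal isotopy, by its numbers of parallel discs.  For a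
  flag \<open>x\<close> of a tetrahedron, \<open>triangles S x\<close> is the number of triangles around the vertex of
  \<open>x\<close>, and \<open>quads S x\<close> is the number of quadrilaterals separating the edge of \<open>x\<close> from the
  opposite edge.
\<close>

record 'f normal_discs =
  triangles :: "'f \<Rightarrow> nat"
  quads :: "'f \<Rightarrow> nat"

definition opposite_edge :: "'f cell_decomp \<Rightarrow> 'f \<Rightarrow> 'f" where
  "opposite_edge T x = edge_sw T (face_sw T (vertex_sw T (edge_sw T x)))"

text \<open>
  The number of arcs in which the surface meets the 2-face of \<open>x\<close> around the vertex of \<open>x\<close>.  If
  \<open>x\<close> has vertex \<open>a\<close>, edge \<open>ab\<close> and face \<open>abc\<close>, then \<open>edge_sw T (vertex_sw T x)\<close> has edge
  \<open>bc\<close>, and the quadrilaterals separating \<open>bc\<close> from the opposite edge are those meeting \<open>abc\<close>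
  in an arc around \<open>a\<close>.
\<close>

definition arcs :: "'f cell_decomp \<Rightarrow> 'f normal_discs \<Rightarrow> 'f \<Rightarrow> nat" where
  "arcs T S x = triangles S x + quads S (edge_sw T (vertex_sw T x))"

text \<open>
  The discs in a tetrahedron can be made disjoint iff at most one of the three quadrilateral types
  occurs; they fit together across the gluings iff in glued 2-faces the arcs around corresponding
  vertices are equally many.
\<close>

definition normal_surface :: "'f cell_decomp \<Rightarrow> 'f normal_discs \<Rightarrow> bool" where
  "normal_surface T S \<longleftrightarrow>
     (\<forall>x \<in> flags T.
        triangles S (edge_sw T x) = triangles S x \<and>
        triangles S (face_sw T x) = triangles S x \<and>
        quads S (vertex_sw T x) = quads S x \<and>
        quads S (face_sw T x) = quads S x \<and>
        quads S (opposite_edge T x) = quads S x \<and>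
        (quads S x > 0 \<longrightarrow> quads S (edge_sw T x) = 0) \<and>
        arcs T S (glue T x) = arcs T S x)"

text \<open>The number of points in which the surface meets the edge of \<open>x\<close>.\<close>

definition edge_weight :: "'f cell_decomp \<Rightarrow> 'f normal_discs \<Rightarrow> 'f \<Rightarrow> nat" where
  "edge_weight T S x = arcs T S x + arcs T S (vertex_sw T x)"

definition identity_off :: "'a set \<Rightarrow> ('a \<Rightarrow> 'a) \<Rightarrow> 'a \<Rightarrow> 'a" where
  "identity_off A h x = (if x \<in> A then h x else x)"

text \<open>
  Cutting along the surface and collapsing its copies to points.  The surface cuts the edge of a flag
  \<open>x\<close> of \<open>T\<close> into segments, numbered \<open>0, \<dots>, edge_weight T S x\<close> from the vertex of \<open>x\<close>.  The flag
  \<open>(x, k)\<close> has as its edge segment \<open>k\<close>, as its vertex the end of this segment nearer to the vertex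
  of \<open>x\<close>, and as its 2-face and 3-cell the regions of the 2-face and the tetrahedron of \<open>x\<close>
  containing the segment.

  Let \<open>v\<close> be the vertex of \<open>x\<close>, and \<open>v'\<close> the other end of its edge.  After the arcs are collapsed,
  segment \<open>k\<close> lies in a bigon at the corner \<open>v\<close> of the 2-face if \<open>k < arcs T S x\<close>, in the central
  triangle if \<open>k = arcs T S x\<close>, and in a bigon at the corner \<open>v'\<close> if \<open>k > arcs T S x\<close>.
  In the last case \<open>edge_sw\<close> leads to the segment with the same number, counted from \<open>v'\<close>, on
  the other edge at \<open>v'\<close>, and to its end farther from \<open>v'\<close>.
\<close>

definition nondestructive_crush ::
    "'f cell_decomp \<Rightarrow> 'f normal_discs \<Rightarrow> ('f \<times> nat) cell_decomp" where
  "nondestructive_crush T S =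
     (let w = edge_weight T S;
          F = {(x, k). x \<in> flags T \<and> k \<le> w x}
      in \<lparr> flags = F,
           vertex_sw = identity_off F (\<lambda>(x, k). (vertex_sw T x, w x - k)),
           edge_sw = identity_off F (\<lambda>(x, k).
             if k \<le> arcs T S x then (edge_sw T x, k)
             else let y = edge_sw T (vertex_sw T x) in (vertex_sw T y, w y - (w x - k))),
           face_sw = identity_off F (\<lambda>(x, k). (face_sw T x, k)),
           glue = identity_off F (\<lambda>(x, k). (glue T x, k)) \<rparr>)"


text \<open>
  Suppose the flags in \<open>R\<close> are collapsed, in such a way that \<open>y \<in> R\<close> becomes identified with
  \<open>g y \<in> R\<close>.  A flag \<open>x \<notin> R\<close> that \<open>f\<close> used to send into \<open>R\<close> is then sent to the first flag outside
  \<open>R\<close> among \<open>f x\<close>, \<open>f (g (f x))\<close>, \<open>f (g (f (g (f x))))\<close>, and so on.  If \<open>f = glue D\<close> and the chain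
  meets a boundary 2-face, it turns back there and ends in \<open>x\<close>, so that \<open>x\<close> becomes a boundary flag.
\<close>

definition bypass :: "'f set \<Rightarrow> ('f \<Rightarrow> 'f) \<Rightarrow> ('f \<Rightarrow> 'f) \<Rightarrow> 'f \<Rightarrow> 'f" where
  "bypass R f g x = ((f \<circ> g) ^^ (LEAST n. ((f \<circ> g) ^^ n) (f x) \<notin> R)) (f x)"

definition polygon :: "'f cell_decomp \<Rightarrow> nat \<Rightarrow> 'f \<Rightarrow> bool" where
  "polygon D n x \<longleftrightarrow> card (face_of D x) = 2 * n"

text \<open>The two sides of a pillow have the same edges and corners in the same order: crossing from one
  side to the other by \<open>face_sw\<close> respects \<open>edge_sw\<close>.\<close>

definition pillow :: "'f cell_decomp \<Rightarrow> nat \<Rightarrow> 'f \<Rightarrow> bool" where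
  "pillow D n x \<longleftrightarrow>
     polygon D n x \<and> polygon D n (face_sw D x) \<and>
     face_of D x \<noteq> face_of D (face_sw D x) \<and>
     cell_of D x = face_of D x \<union> face_of D (face_sw D x) \<and>
     (\<forall>y \<in> cell_of D x. face_sw D (edge_sw D y) = edge_sw D (face_sw D y))"

definition flatten_pillow :: "'f cell_decomp \<Rightarrow> 'f \<Rightarrow> 'f cell_decomp" where
  "flatten_pillow D x =
     (let R = cell_of D x; F = flags D - R
      in \<lparr> flags = F,
           vertex_sw = identity_off F (vertex_sw D),
           edge_sw = identity_off F (edge_sw D),
           face_sw = identity_off F (face_sw D),
           glue = identity_off F (bypass R (glue D) (face_sw D)) \<rparr>)"

text \<open>An internal bigon has a side in each of the two cells (or twice in the one cell) that
  contain it; both are removed.  The two edges of a side become one, so that the 2-faces beyond them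
  become adjacent.\<close>

definition flatten_bigon :: "'f cell_decomp \<Rightarrow> 'f \<Rightarrow> 'f cell_decomp" where
  "flatten_bigon D x =
     (let R = face_of D x \<union> face_of D (glue D x); F = flags D - R
      in \<lparr> flags = F,
           vertex_sw = identity_off F (vertex_sw D),
           edge_sw = identity_off F (edge_sw D),
           face_sw = identity_off F (bypass R (face_sw D) (edge_sw D)),
           glue = identity_off F (glue D) \<rparr>)"

definition atomic_operation :: "'f cell_decomp \<Rightarrow> 'f cell_decomp \<Rightarrow> bool" where
  "atomic_operation D D' \<longleftrightarrow>
     cell_decomposition D \<and> cell_decomposition D' \<and>
     (\<exists>x \<in> flags D.
        (pillow D 3 x \<and> D' = flatten_pillow D x) \<or>
        (pillow D 2 x \<and> D' = flatten_pillow D x) \<or>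
        (polygon D 2 x \<and> D' = flatten_bigon D x))"


text \<open>
  All cells other than tetrahedra are flattened simultaneously.  In \<open>nondestructive_crush T S\<close> they
  are footballs, which have bigon faces only, and triangular purses.  In a purse every bigon becomes
  an edge, and then the two triangles become one: \<open>across\<close> sends a flag of one triangle to the flag
  of the other with which it is identified.  The tetrahedra have no bigon faces and survive
  unchanged; two of their 2-faces end up glued if they are linked by a (possibly empty) chain of purses.
\<close>

definition flatten_non_tetrahedra :: "'f cell_decomp \<Rightarrow> 'f cell_decomp" where
  "flatten_non_tetrahedra D =
     (let F = {x \<in> flags D. tetrahedron D x};
          B = {x \<in> flags D. polygon D 2 x};
          across = bypass B (face_sw D) (edge_sw D)
      in \<lparr> flags = F,
           vertex_sw = identity_off F (vertex_sw D),
           edge_sw = identity_off F (edge_sw D),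
           face_sw = identity_off F (face_sw D),
           glue = identity_off F (bypass (flags D - F) (glue D) across) \<rparr>)"

definition destructive_crush ::
    "'f cell_decomp \<Rightarrow> 'f normal_discs \<Rightarrow> ('f \<times> nat) cell_decomp" where
  "destructive_crush T S = flatten_non_tetrahedra (nondestructive_crush T S)"

end

theory Submission
  imports Defs
begin

text \<open>
  The cells of the crushed decomposition other than tetrahedra are flattened one at a time.  If some
  cell is a bigonal pillow, flatten it; otherwise flatten a bigon, as long as there is one; when no
  bigons are left, all remaining purses have become triangular pillows.  Flattening a bigon would be
  illegal only if it left a football with a single bigon.  As no football is a pillow, this happens
  only if two faces of a 3-sided football are glued to each other, and then the third bigon can be
  flattened instead.  The result of flattening all non-tetrahedra simultaneously is an invariant of
  these operations, since a chain of flags that are skipped may be shortened in steps.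

  The Euler condition follows from the shape of the cells (tetrahedron, football, or a cell that
  becomes a triangular pillow once its bigons are removed).
\<close>

section \<open>Orbits\<close>

text \<open>Neither the Euler condition nor the shape of a purse passes easily through the
  flattening of a bigon. The Euler condition is therefore split off from the other axioms
  (\<open>flag_complex\<close>) and recovered at every stage by counting flags; an edge of a cell
  always has 4 of them. The shape of a purse is replaced by a property of \<open>across\<close>, the
  adjacency of its triangles once all its bigons are gone: flattening some of these bigons
  beforehand leaves \<open>across\<close> unchanged. Both atomic flattenings and the simultaneous
  one are instances of \<open>bypass\<close>, so that one study of chains (they end, they can be
  reversed, they can be skipped in stages) serves throughout. On the crushed decomposition itself
  the hard axiom is that the corners of a 2-face are distinct vertices of the 3-cell; it is proved
  by labelling each vertex with the disc, or tetrahedron vertex, that it comes from. Since every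
  operation deletes flags, the process ends.\<close>

lemma flag_orbit_refl [simp]: "x \<in> flag_orbit A x"
  by (simp add: flag_orbit_def)

lemma flag_orbit_step: "y \<in> flag_orbit A x \<Longrightarrow> h \<in> A \<Longrightarrow> h y \<in> flag_orbit A x"
  unfolding flag_orbit_def by (auto intro: rtrancl_into_rtrancl)

lemma flag_orbit_induct [consumes 1, case_names base step]:
  assumes "y \<in> flag_orbit A x" and "P x"
    and "\<And>y h. y \<in> flag_orbit A x \<Longrightarrow> P y \<Longrightarrow> h \<in> A \<Longrightarrow> P (h y)"
  shows "P y"
proof -
  have "(x, y) \<in> {(u, h u) |u h. h \<in> A}\<^sup>*" using assms(1) by (simp add: flag_orbit_def)
  then show ?thesis
  proof (induction rule: rtrancl_induct)
    case base
    show ?case by (rule assms(2))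
  next
    case (step y z)
    then have "y \<in> flag_orbit A x" by (simp add: flag_orbit_def)
    then show ?case using step assms(3)[of y] by blast
  qed
qed

lemma flag_orbit_subset:
  assumes "x \<in> S" and "\<And>y h. y \<in> S \<Longrightarrow> h \<in> A \<Longrightarrow> h y \<in> S"
  shows "flag_orbit A x \<subseteq> S"
proof
  fix y assume "y \<in> flag_orbit A x"
  then show "y \<in> S" by (induction rule: flag_orbit_induct) (use assms in auto)
qed

lemma flag_orbit_trans:
  assumes "y \<in> flag_orbit A x"
  shows "flag_orbit A y \<subseteq> flag_orbit A x"
  using assms by (intro flag_orbit_subset) (auto intro: flag_orbit_step)

lemma flag_orbit_mono: "A \<subseteq> A' \<Longrightarrow> flag_orbit A x \<subseteq> flag_orbit A' x"
  by (intro flag_orbit_subset) (auto intro: flag_orbit_step)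

lemma flag_orbit_eq:
  assumes "y \<in> flag_orbit A x" and inv: "\<And>h z. h \<in> A \<Longrightarrow> h (h z) = z"
  shows "flag_orbit A y = flag_orbit A x"
proof
  show "flag_orbit A y \<subseteq> flag_orbit A x" using assms(1) by (rule flag_orbit_trans)
  from assms(1) have "x \<in> flag_orbit A y"
  proof (induction rule: flag_orbit_induct)
    case (step y h)
    have "y \<in> flag_orbit A (h y)"
      using flag_orbit_step[OF flag_orbit_refl step.hyps(2), of "h y"] inv[OF step.hyps(2)] by simp
    then have "flag_orbit A y \<subseteq> flag_orbit A (h y)" by (rule flag_orbit_trans)
    then show ?case using step.IH by (rule subsetD)
  qed simp
  then show "flag_orbit A x \<subseteq> flag_orbit A y" by (rule flag_orbit_trans)
qed

lemma flag_orbit_cong: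
  assumes "x \<in> S" and closed: "\<And>y h. y \<in> S \<Longrightarrow> h \<in> A \<Longrightarrow> h y \<in> S"
    and "\<And>h. h \<in> A \<Longrightarrow> \<exists>h' \<in> A'. \<forall>y \<in> S. h' y = h y"
    and "\<And>h. h \<in> A' \<Longrightarrow> \<exists>h' \<in> A. \<forall>y \<in> S. h y = h' y"
  shows "flag_orbit A' x = flag_orbit A x"
proof
  have sub: "flag_orbit A x \<subseteq> S" using assms(1,2) by (rule flag_orbit_subset)
  show "flag_orbit A' x \<subseteq> flag_orbit A x"
  proof (rule flag_orbit_subset)
    fix y h assume y: "y \<in> flag_orbit A x" and "h \<in> A'"
    then obtain h' where "h' \<in> A" "h y = h' y" using assms(4) sub by blast
    then show "h y \<in> flag_orbit A x" using y by (simp add: flag_orbit_step)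
  qed simp
  have "flag_orbit A x \<subseteq> S \<inter> flag_orbit A' x"
  proof (rule flag_orbit_subset)
    fix y h assume y: "y \<in> S \<inter> flag_orbit A' x" and h: "h \<in> A"
    then obtain h' where "h' \<in> A'" "h' y = h y" using assms(3) by blast
    then show "h y \<in> S \<inter> flag_orbit A' x"
      using y h closed flag_orbit_step[of y A' x h'] by auto
  qed (use assms(1) in simp)
  then show "flag_orbit A x \<subseteq> flag_orbit A' x" by blast
qed

text \<open>The source of the Euler counts: a cell is a finite set of flags, and its edges, its
  faces of one kind and often its vertices partition flags into blocks of known size.\<close>

lemma card_classes:
  assumes "finite c" and "\<And>x. x \<in> c \<Longrightarrow> x \<in> P x" and "\<And>x. x \<in> c \<Longrightarrow> P x \<subseteq> c"
    and "\<And>x y. x \<in> c \<Longrightarrow> y \<in> P x \<Longrightarrow> P y = P x" and "\<And>x. x \<in> c \<Longrightarrow> card (P x) = n"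
  shows "n * card (P ` c) = card c"
proof -
  have U: "\<Union> (P ` c) = c" using assms(2,3) by blast
  have "n * card (P ` c) = card (\<Union> (P ` c))"
  proof (rule card_partition)
    show "c1 \<inter> c2 = {}" if c: "c1 \<in> P ` c" "c2 \<in> P ` c" "c1 \<noteq> c2" for c1 c2
    proof (rule ccontr)
      assume "c1 \<inter> c2 \<noteq> {}"
      then obtain z where z: "z \<in> c1" "z \<in> c2" by blast
      obtain x y where "x \<in> c" "y \<in> c" "c1 = P x" "c2 = P y" using c by blast
      then have "P z = c1" "P z = c2" using assms(4)[of x z] assms(4)[of y z] z by auto
      then show False using c by simp
    qed
  qed (use assms(1,5) U in auto)
  then show ?thesis using U by simp
qed

section \<open>Restriction and bypassing\<close>

lemma identity_off_in [simp]: "x \<in> A \<Longrightarrow> identity_off A h x = h x"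
  and identity_off_out [simp]: "x \<notin> A \<Longrightarrow> identity_off A h x = x"
  by (simp_all add: identity_off_def)

lemma identity_off_invol:
  assumes "\<And>x. x \<in> A \<Longrightarrow> h x \<in> A" and "\<And>x. x \<in> A \<Longrightarrow> h (h x) = x"
  shows "identity_off A h (identity_off A h x) = x"
  using assms by (simp add: identity_off_def)

lemma identity_off_permutes:
  assumes "\<And>x. x \<in> A \<Longrightarrow> h x \<in> A" and "\<And>x. x \<in> A \<Longrightarrow> h (h x) = x"
  shows "identity_off A h permutes A"
  unfolding permutes_def
proof (intro conjI allI impI)
  fix y
  note inv = identity_off_invol[of A h, OF assms]
  show "\<exists>!x. identity_off A h x = y"
  proof (rule ex1I[of _ "identity_off A h y"])
    show "x = identity_off A h y" if "identity_off A h x = y" for x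
      unfolding that[symmetric] by (rule inv[symmetric])
  qed (rule inv)
qed simp

lemma flag_orbit_identity_off:
  assumes "x \<in> G" and "\<forall>h \<in> A. \<forall>y \<in> G. h y \<in> G"
  shows "flag_orbit (identity_off G ` A) x = flag_orbit A x"
  by (rule flag_orbit_cong[where S = G]) (use assms in auto)

lemma identity_off_permuted:
  assumes "h permutes A"
  shows "identity_off A h = h"
  using assms by (auto simp: identity_off_def permutes_def fun_eq_iff)

text \<open>The \<open>LEAST\<close> in \<open>bypass\<close> is meaningful only if the chain leaves
  \<open>R\<close>. Saying this inductively provides induction along the chain, on which most lemmas
  about \<open>exit\<close> rest.\<close>

inductive leaves :: "'a set \<Rightarrow> ('a \<Rightarrow> 'a) \<Rightarrow> ('a \<Rightarrow> 'a) \<Rightarrow> 'a \<Rightarrow> bool" for R f g where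
  out: "z \<notin> R \<Longrightarrow> leaves R f g z"
| into: "z \<in> R \<Longrightarrow> leaves R f g (f (g z)) \<Longrightarrow> leaves R f g z"

text \<open>Unlike \<open>bypass\<close>, this may start anywhere on a chain, also in its middle, so
  that it obeys the recursion \<open>exit_into\<close>.\<close>

definition exit :: "'a set \<Rightarrow> ('a \<Rightarrow> 'a) \<Rightarrow> ('a \<Rightarrow> 'a) \<Rightarrow> 'a \<Rightarrow> 'a" where
  "exit R f g z = ((f \<circ> g) ^^ (LEAST n. ((f \<circ> g) ^^ n) z \<notin> R)) z"

lemma bypass_exit: "bypass R f g x = exit R f g (f x)"
  by (simp add: bypass_def exit_def)

lemma exit_out [simp]: "z \<notin> R \<Longrightarrow> exit R f g z = z"
  by (simp add: exit_def Least_eq_0)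

lemma funpow_comp_Suc: "((f \<circ> g) ^^ Suc n) z = ((f \<circ> g) ^^ n) (f (g z))"
  by (subst funpow_Suc_right) (simp only: o_apply)

lemma leaves_funpow: "((f \<circ> g) ^^ n) z \<notin> R \<Longrightarrow> leaves R f g z"
proof (induction n arbitrary: z)
  case (Suc n)
  then have "leaves R f g (f (g z))" by (simp only: funpow_comp_Suc not_False_eq_True)
  then show ?case by (cases "z \<in> R") (auto intro: leaves.intros)
qed (simp add: leaves.out)

lemma funpow_leaves: "leaves R f g z \<Longrightarrow> \<exists>n. ((f \<circ> g) ^^ n) z \<notin> R"
proof (induction rule: leaves.induct)
  case (out z)
  then show ?case by (intro exI[of _ 0]) simp
next
  case (into z)
  then obtain n where "((f \<circ> g) ^^ n) (f (g z)) \<notin> R" by blast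
  then have "((f \<circ> g) ^^ Suc n) z \<notin> R" by (simp only: funpow_comp_Suc not_False_eq_True)
  then show ?case by blast
qed

lemma exit_into:
  assumes "z \<in> R" and "leaves R f g (f (g z))"
  shows "exit R f g z = exit R f g (f (g z))"
proof -
  obtain n where n: "((f \<circ> g) ^^ n) z \<notin> R"
    using funpow_leaves[OF leaves.into[OF assms]] by blast
  have "(LEAST n. ((f \<circ> g) ^^ n) z \<notin> R) = Suc (LEAST n. ((f \<circ> g) ^^ Suc n) z \<notin> R)"
    using n assms(1) by (intro Least_Suc) auto
  then show ?thesis
    unfolding exit_def by (simp only: funpow_comp_Suc not_False_eq_True)
qed

lemma exit_closed:
  assumes "leaves R f g z" and "z \<in> S" and "\<And>y. y \<in> S \<inter> R \<Longrightarrow> f (g y) \<in> S"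
  shows "exit R f g z \<in> S - R"
  using assms(1,2)
proof (induction rule: leaves.induct)
  case (into z)
  then show ?case using assms(3) by (simp add: exit_into)
qed simp

lemma exit_commute:
  assumes "leaves R f g z" and "z \<in> S"
    and "\<And>y. y \<in> S \<Longrightarrow> f y \<in> S" and "\<And>y. y \<in> S \<inter> R \<Longrightarrow> g y \<in> S"
    and "\<And>y. y \<in> S \<Longrightarrow> h y \<in> R \<longleftrightarrow> y \<in> R"
    and "\<And>y. y \<in> S \<Longrightarrow> h (f y) = f (h y)" and "\<And>y. y \<in> S \<inter> R \<Longrightarrow> h (g y) = g (h y)"
  shows "leaves R f g (h z) \<and> exit R f g (h z) = h (exit R f g z)"
  using assms(1,2)
proof (induction rule: leaves.induct)
  case (out z)
  then show ?case using assms(5) by (simp add: leaves.out)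
next
  case (into z)
  have eq: "h (f (g z)) = f (g (h z))" using into.hyps into.prems assms(4,6,7) by auto
  have "h z \<in> R" using into assms(5) by auto
  moreover have "leaves R f g (f (g (h z))) \<and> exit R f g (f (g (h z))) = h (exit R f g (f (g z)))"
    using into assms(3,4) eq by auto
  ultimately show ?case using into.hyps by (simp add: leaves.into exit_into)
qed

lemma exit_cong:
  assumes "leaves R f g z" and "z \<in> S"
    and "\<And>y. y \<in> S \<Longrightarrow> f y \<in> S" and "\<And>y. y \<in> S \<inter> R \<Longrightarrow> g y \<in> S"
    and "\<And>y. y \<in> S \<Longrightarrow> y \<in> R' \<longleftrightarrow> y \<in> R"
    and "\<And>y. y \<in> S \<Longrightarrow> f' y = f y" and "\<And>y. y \<in> S \<inter> R \<Longrightarrow> g' y = g y"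
  shows "leaves R' f' g' z \<and> exit R' f' g' z = exit R f g z"
  using assms(1,2)
proof (induction rule: leaves.induct)
  case (out z)
  then show ?case using assms(5) by (simp add: leaves.out)
next
  case (into z)
  have eq: "f' (g' z) = f (g z)" and "z \<in> R'" using into.hyps into.prems assms(4-7) by auto
  moreover have "leaves R' f' g' (f (g z)) \<and> exit R' f' g' (f (g z)) = exit R f g (f (g z))"
    using into assms(3,4) by auto
  ultimately show ?case using into.hyps exit_into[of z R' f' g'] leaves.into[of z R' f' g']
    by (simp add: exit_into)
qed

text \<open>Each step of \<open>bypass R f g\<close> traverses a whole stretch of the long chain
  inside \<open>R\<close>, so skipping in two stages ends where skipping at once does. This is why
  the simultaneous flattening can be carried out piece by piece.\<close>

lemma exit_exit:
  assumes "leaves W f g z" and "R \<subseteq> W"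
  shows "leaves R f g z" and
    "leaves (W - R) (bypass R f g) g (exit R f g z) \<and>
     exit (W - R) (bypass R f g) g (exit R f g z) = exit W f g z"
proof -
  show 1: "leaves R f g z"
    using assms(1)
  proof (induction rule: leaves.induct)
    case (out z)
    then show ?case using assms(2) by (auto intro: leaves.out)
  next
    case (into z)
    then show ?case by (cases "z \<in> R") (auto intro: leaves.intros)
  qed
  show "leaves (W - R) (bypass R f g) g (exit R f g z) \<and>
     exit (W - R) (bypass R f g) g (exit R f g z) = exit W f g z"
    using assms(1)
  proof (induction rule: leaves.induct)
    case (out z)
    then have "z \<notin> R" "z \<notin> W - R" using assms(2) by auto
    then show ?case using out by (simp add: leaves.out)
  next
    case (into z)
    have lR: "leaves R f g (f (g z))"
      using into.hyps(2)
    proof (induction rule: leaves.induct)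
      case (out z)
      then show ?case using assms(2) by (auto intro: leaves.out)
    next
      case (into z)
      then show ?case by (cases "z \<in> R") (auto intro: leaves.intros)
    qed
    show ?case
    proof (cases "z \<in> R")
      case True
      then show ?thesis using into lR by (simp add: exit_into)
    next
      case False
      have "bypass R f g (g z) = exit R f g (f (g z))" by (simp add: bypass_exit)
      then show ?thesis
        using into False exit_into[of z "W - R" "bypass R f g" g]
          leaves.into[of z "W - R" "bypass R f g" g]
        by (simp add: exit_into)
    qed
  qed
qed

locale bypassing =
  fixes S R :: "'a set" and f g :: "'a \<Rightarrow> 'a"
  assumes finite: "finite S"
    and f_closed: "x \<in> S \<Longrightarrow> f x \<in> S" and f_invol: "x \<in> S \<Longrightarrow> f (f x) = x"
    and g_closed: "x \<in> S \<Longrightarrow> x \<in> R \<Longrightarrow> g x \<in> S \<and> g x \<in> R"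
    and g_invol: "x \<in> S \<Longrightarrow> x \<in> R \<Longrightarrow> g (g x) = x"
begin

text \<open>Inside \<open>R\<close> the step \<open>f \<circ> g\<close> is injective, so a chain
  that stays in \<open>R\<close> within the finite set \<open>S\<close> would be periodic from its
  first element on. Then \<open>f x\<close> is itself the result of a step, which makes
  \<open>x\<close> a value of \<open>g\<close> on \<open>R\<close>; but \<open>g\<close> preserves
  \<open>R\<close> and \<open>x\<close> is outside.\<close>

lemma leaves_first:
  assumes x: "x \<in> S - R"
  shows "leaves R f g (f x)"
proof (rule ccontr)
  assume neg: "\<not> leaves R f g (f x)"
  define u where "u n = ((f \<circ> g) ^^ n) (f x)" for n
  have uR: "u n \<in> R" for n using neg leaves_funpow[of n f g "f x" R] by (auto simp: u_def)
  have u0: "u 0 = f x" and uS: "u (Suc n) = f (g (u n))" for n by (simp_all add: u_def)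
  have uS': "u n \<in> S" for n
  proof (induction n)
    case (Suc n)
    then show ?case using uS[of n] uR[of n] f_closed g_closed by simp
  qed (use u0 x f_closed in simp)
  have cancel: "u m = u n" if "u (Suc m) = u (Suc n)" for m n
    using that uR uS' uS g_closed f_invol g_invol by metis
  have shift: "u 0 = u k" if "u m = u (m + k)" for m k
    using that
  proof (induction m)
    case (Suc m)
    then show ?case using cancel[of m "m + k"] by simp
  qed simp
  have "\<not> inj u"
  proof
    assume "inj u"
    moreover have "finite (range u)" using uS' finite by (auto intro: finite_subset)
    ultimately show False using finite_imageD by blast
  qed
  then obtain m n where "u m = u n" "m < n"
    unfolding inj_def by (metis linorder_neqE_nat)
  then have "u 0 = u (n - m)" using shift[of m "n - m"] by simp
  moreover obtain k where "n - m = Suc k" using \<open>m < n\<close> by (metis Suc_diff_Suc)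
  ultimately have "f x = f (g (u k))" using u0 uS by simp
  then have "x = g (u k)" using f_invol x uS' uR g_closed by (metis DiffD1)
  then show False using x uS' uR g_closed by blast
qed

lemma bypass_in: "x \<in> S - R \<Longrightarrow> bypass R f g x \<in> S - R"
  unfolding bypass_exit
  by (rule exit_closed[OF leaves_first]) (use f_closed g_closed in auto)

text \<open>As \<open>f\<close> and \<open>g\<close> are involutions, a chain read backwards is
  again a chain: from the exit of \<open>z\<close>, applying \<open>f\<close> leads back along it to
  \<open>f z\<close> and on to the other end. For \<open>z = f x\<close> with \<open>x\<close>
  outside \<open>R\<close>, that other end is \<open>x\<close>.\<close>

lemma exit_reverse:
  assumes "leaves R f g z" and "z \<in> S" and "leaves R f g (f z)"
  shows "exit R f g (f (exit R f g z)) = exit R f g (f z)"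
  using assms
proof (induction rule: leaves.induct)
  case (into z)
  have gz: "g z \<in> S" "g z \<in> R" "f (f (g z)) = g z" "g (g z) = z"
    using into g_closed f_closed f_invol g_invol by auto
  have l: "leaves R f g (f (g (g z)))" using gz into.prems by simp
  have "leaves R f g (f (f (g z)))" using leaves.into[OF gz(2) l] gz by simp
  then have "exit R f g (f (exit R f g (f (g z)))) = exit R f g (f (f (g z)))"
    using into.IH gz f_closed by blast
  also have "\<dots> = exit R f g (f z)" using exit_into[OF gz(2) l] gz by simp
  finally show ?case using into.hyps by (simp add: exit_into)
qed simp

lemma bypass_invol:
  assumes x: "x \<in> S - R"
  shows "bypass R f g (bypass R f g x) = x"
proof -
  have "leaves R f g (f (f x))" using x f_invol by (simp add: leaves.out)
  then show ?thesis using exit_reverse[OF leaves_first[OF x]] x f_closed f_invol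
    by (simp add: bypass_exit)
qed

text \<open>The chain from \<open>x\<close> back to \<open>x\<close> would be a palindrome, whose middle is a fixed point of
  \<open>f\<close> or \<open>g\<close>.\<close>

lemma bypass_neq:
  assumes x: "x \<in> S - R" and f_neq: "\<And>y. y \<in> S \<Longrightarrow> f y \<noteq> y" and g_neq: "\<And>y. y \<in> S \<Longrightarrow> y \<in> R \<Longrightarrow> g y \<noteq> y"
  shows "bypass R f g x \<noteq> x"
proof
  assume fixed: "bypass R f g x = x"
  define u where "u n = ((f \<circ> g) ^^ n) (f x)" for n
  define N where "N = (LEAST n. u n \<notin> R)"
  have N: "u N = x" using fixed by (simp add: bypass_def u_def N_def)
  have u0: "u 0 = f x" and uS: "u (Suc n) = f (g (u n))" for n by (simp_all add: u_def)
  have uR: "u n \<in> R" if "n < N" for n using that not_less_Least unfolding N_def by blast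
  have u: "u n \<in> S" if "n < N" for n
    using that
  proof (induction n)
    case (Suc n)
    then show ?case using uS[of n] uR[of n] f_closed g_closed by simp
  qed (use u0 x f_closed in simp)
  have N0: "N \<noteq> 0" using N u0 f_neq x by (metis DiffD1)
  have pal: "g (u (N - Suc i)) = u i" if "i < N" for i
    using that
  proof (induction i)
    case 0
    have "x = f (g (u (N - 1)))" using N uS[of "N - 1"] N0 by simp
    then have "f x = g (u (N - 1))" using u[of "N - 1"] uR[of "N - 1"] N0 g_closed f_invol by simp
    then show ?case using u0 by simp
  next
    case (Suc i)
    let ?j = "N - Suc (Suc i)"
    have j: "N - Suc i = Suc ?j" "?j < N" using Suc.prems by simp_all
    have "g (u i) = u (N - Suc i)"
      using Suc u[of "N - Suc i"] uR[of "N - Suc i"] g_invol[of "u (N - Suc i)"] by simp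
    then have "u (Suc i) = f (f (g (u ?j)))" using uS[of i] uS[of ?j] j by simp
    then show ?case using f_invol g_closed u[OF j(2)] uR[OF j(2)] by simp
  qed
  show False
  \<comment> \<open>For odd \<open>N\<close> the middle of the palindrome is a fixed point of
    \<open>g\<close>, for even \<open>N\<close> one of \<open>f\<close>.\<close>
  proof (cases "odd N")
    case True
    then obtain i where i: "N = Suc (2 * i)" by (auto elim!: oddE)
    then have "g (u i) = u i" using pal[of i] i by simp
    then show False using g_neq[of "u i"] u[of i] uR[of i] i by simp
  next
    case False
    then obtain k where "N = 2 * k" by (auto elim!: evenE)
    moreover then obtain i where "k = Suc i" using N0 by (cases k) auto
    ultimately have i: "N = Suc (Suc (2 * i))" by simp
    then have "g (u i) = f (g (u i))" using pal[of "Suc i"] uS[of i] by simp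
    then show False using f_neq[of "g (u i)"] g_closed u[of i] uR[of i] i by simp
  qed
qed

lemma bypass_commute:
  assumes "x \<in> S - R" and "\<And>y. y \<in> S \<Longrightarrow> h y \<in> R \<longleftrightarrow> y \<in> R"
    and "\<And>y. y \<in> S \<Longrightarrow> h (f y) = f (h y)" and "\<And>y. y \<in> S \<Longrightarrow> y \<in> R \<Longrightarrow> h (g y) = g (h y)"
  shows "bypass R f g (h x) = h (bypass R f g x)"
proof -
  have "exit R f g (h (f x)) = h (exit R f g (f x))"
    using exit_commute[OF leaves_first[OF assms(1)], of S h] assms f_closed g_closed by auto
  then show ?thesis using assms(1,3) by (simp add: bypass_exit)
qed

lemma bypass_cong:
  assumes "x \<in> S - R" and "\<And>y. y \<in> S \<Longrightarrow> y \<in> R' \<longleftrightarrow> y \<in> R"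
    and "\<And>y. y \<in> S \<Longrightarrow> f' y = f y" and "\<And>y. y \<in> S \<Longrightarrow> y \<in> R \<Longrightarrow> g' y = g y"
  shows "bypass R' f' g' x = bypass R f g x"
proof -
  have "exit R' f' g' (f x) = exit R f g (f x)"
    using exit_cong[OF leaves_first[OF assms(1)], of S R' f' g'] assms f_closed g_closed by auto
  then show ?thesis using assms(1,3) by (simp add: bypass_exit)
qed

lemma bypass_bypass:
  assumes "x \<in> S - R" and "R' \<subseteq> R"
  shows "bypass (R - R') (bypass R' f g) g x = bypass R f g x"
  using exit_exit[OF leaves_first[OF assms(1)] assms(2)] by (simp add: bypass_exit)

end

section \<open>Decompositions before the Euler condition\<close>

definition euler :: "'f cell_decomp \<Rightarrow> 'f \<Rightarrow> bool" where
  "euler D x \<longleftrightarrow> card (vertex_of D ` cell_of D x) + card (face_of D ` cell_of D x)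
          = card (edge_of D ` cell_of D x) + 2"

definition bigons :: "'f cell_decomp \<Rightarrow> 'f set" where
  "bigons D = {x \<in> flags D. polygon D 2 x}"

locale flag_complex =
  fixes D :: "'f cell_decomp"
  assumes finite_flags: "finite (flags D)"
    and switches: "h \<in> {vertex_sw D, edge_sw D, face_sw D, glue D} \<Longrightarrow>
        h permutes flags D \<and> (\<forall>x. h (h x) = x)"
    and incidence: "x \<in> flags D \<Longrightarrow>
        vertex_sw D x \<noteq> x \<and> edge_sw D x \<noteq> x \<and> vertex_sw D x \<noteq> edge_sw D x \<and>
        vertex_sw D (face_sw D x) = face_sw D (vertex_sw D x) \<and>
        face_sw D x \<notin> face_of D x \<and>
        vertex_of D x \<inter> face_of D x \<subseteq> {x, edge_sw D x} \<and>
        glue D (vertex_sw D x) = vertex_sw D (glue D x) \<and>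
        glue D (edge_sw D x) = edge_sw D (glue D x) \<and>
        (glue D x \<noteq> x \<longrightarrow> glue D x \<notin> face_of D x)"

lemma cell_decomposition_iff:
  "cell_decomposition D \<longleftrightarrow> flag_complex D \<and> (\<forall>x \<in> flags D. euler D x)"
proof
  assume D: "cell_decomposition D"
  note D = D[unfolded cell_decomposition_def]
  have "flag_complex D"
    using D by (intro flag_complex.intro) (blast, blast, simp)
  moreover have "\<forall>x \<in> flags D. euler D x" using D by (simp add: euler_def)
  ultimately show "flag_complex D \<and> (\<forall>x \<in> flags D. euler D x)" ..
next
  assume "flag_complex D \<and> (\<forall>x \<in> flags D. euler D x)"
  then show "cell_decomposition D"
    unfolding cell_decomposition_def flag_complex_def euler_def by simp
qed

context flag_complex
begin

abbreviation "v \<equiv> vertex_sw D"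
abbreviation "e \<equiv> edge_sw D"
abbreviation "f \<equiv> face_sw D"
abbreviation "gl \<equiv> glue D"

lemma invol [simp]: "v (v x) = x" "e (e x) = x" "f (f x) = x" "gl (gl x) = x"
  using switches by blast+

lemma in_flags [simp]:
  "v x \<in> flags D \<longleftrightarrow> x \<in> flags D" "e x \<in> flags D \<longleftrightarrow> x \<in> flags D"
  "f x \<in> flags D \<longleftrightarrow> x \<in> flags D" "gl x \<in> flags D \<longleftrightarrow> x \<in> flags D"
  by (rule permutes_in_image, rule conjunct1[OF switches], simp)+

lemma vf: "x \<in> flags D \<Longrightarrow> v (f x) = f (v x)"
  and glv: "x \<in> flags D \<Longrightarrow> gl (v x) = v (gl x)"
  and gle: "x \<in> flags D \<Longrightarrow> gl (e x) = e (gl x)"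
  and f_notin_face: "x \<in> flags D \<Longrightarrow> f x \<notin> face_of D x"
  and v_neq: "x \<in> flags D \<Longrightarrow> v x \<noteq> x" and e_neq: "x \<in> flags D \<Longrightarrow> e x \<noteq> x"
  and v_neq_e: "x \<in> flags D \<Longrightarrow> v x \<noteq> e x"
  and gl_notin_face: "x \<in> flags D \<Longrightarrow> gl x \<noteq> x \<Longrightarrow> gl x \<notin> face_of D x"
  and vertex_Int_face: "x \<in> flags D \<Longrightarrow> y \<in> vertex_of D x \<Longrightarrow> y \<in> face_of D x \<Longrightarrow> y = x \<or> y = e x"
  using incidence[of x] by auto

lemma self_in [simp]: "x \<in> cell_of D x" "x \<in> face_of D x" "x \<in> edge_of D x" "x \<in> vertex_of D x"
  by (simp_all add: cell_of_def face_of_def edge_of_def vertex_of_def)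

lemma face_of_eq: "y \<in> face_of D x \<Longrightarrow> face_of D y = face_of D x"
  and cell_of_eq: "y \<in> cell_of D x \<Longrightarrow> cell_of D y = cell_of D x"
  and vertex_of_eq: "y \<in> vertex_of D x \<Longrightarrow> vertex_of D y = vertex_of D x"
  and edge_of_eq: "y \<in> edge_of D x \<Longrightarrow> edge_of D y = edge_of D x"
  unfolding face_of_def cell_of_def vertex_of_def edge_of_def
  by (rule flag_orbit_eq, assumption, elim insertE emptyE, simp_all)+

lemma face_step: "y \<in> face_of D x \<Longrightarrow> v y \<in> face_of D x" "y \<in> face_of D x \<Longrightarrow> e y \<in> face_of D x"
  and cell_step: "y \<in> cell_of D x \<Longrightarrow> v y \<in> cell_of D x" "y \<in> cell_of D x \<Longrightarrow> e y \<in> cell_of D x"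
    "y \<in> cell_of D x \<Longrightarrow> f y \<in> cell_of D x"
  and vertex_step: "y \<in> vertex_of D x \<Longrightarrow> e y \<in> vertex_of D x" "y \<in> vertex_of D x \<Longrightarrow> f y \<in> vertex_of D x"
  and edge_step: "y \<in> edge_of D x \<Longrightarrow> v y \<in> edge_of D x" "y \<in> edge_of D x \<Longrightarrow> f y \<in> edge_of D x"
  unfolding face_of_def cell_of_def vertex_of_def edge_of_def by (simp_all add: flag_orbit_step)

lemma face_sub: "face_of D x \<subseteq> cell_of D x" and edge_sub: "edge_of D x \<subseteq> cell_of D x"
  and vertex_sub: "vertex_of D x \<subseteq> cell_of D x"
  unfolding face_of_def cell_of_def vertex_of_def edge_of_def by (rule flag_orbit_mono, blast)+

lemma face_of_minimal: "x \<in> S \<Longrightarrow> (\<And>y. y \<in> S \<Longrightarrow> v y \<in> S \<and> e y \<in> S) \<Longrightarrow> face_of D x \<subseteq> S"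
  unfolding face_of_def by (rule flag_orbit_subset) auto

lemma cell_of_minimal:
  "x \<in> S \<Longrightarrow> (\<And>y. y \<in> S \<Longrightarrow> v y \<in> S \<and> e y \<in> S \<and> f y \<in> S) \<Longrightarrow> cell_of D x \<subseteq> S"
  unfolding cell_of_def by (rule flag_orbit_subset) auto

lemma vertex_of_minimal: "x \<in> S \<Longrightarrow> (\<And>y. y \<in> S \<Longrightarrow> e y \<in> S \<and> f y \<in> S) \<Longrightarrow> vertex_of D x \<subseteq> S"
  unfolding vertex_of_def by (rule flag_orbit_subset) auto

lemma cell_flags: "x \<in> flags D \<Longrightarrow> cell_of D x \<subseteq> flags D"
  by (rule cell_of_minimal) auto

lemma face_flags: "x \<in> flags D \<Longrightarrow> face_of D x \<subseteq> flags D"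
  using cell_flags face_sub by blast

lemma finite_cell: "x \<in> flags D \<Longrightarrow> finite (cell_of D x)"
  using cell_flags finite_flags finite_subset by blast

lemma finite_face: "x \<in> flags D \<Longrightarrow> finite (face_of D x)"
  using face_flags finite_flags finite_subset by blast

lemma face_of_v [simp]: "face_of D (v x) = face_of D x" and face_of_e [simp]: "face_of D (e x) = face_of D x"
  by (simp_all add: face_of_eq face_step)

lemma cell_of_v [simp]: "cell_of D (v x) = cell_of D x" and cell_of_e [simp]: "cell_of D (e x) = cell_of D x"
  and cell_of_f [simp]: "cell_of D (f x) = cell_of D x"
  by (simp_all add: cell_of_eq cell_step)

lemma vertex_of_e [simp]: "vertex_of D (e x) = vertex_of D x"
  and vertex_of_f [simp]: "vertex_of D (f x) = vertex_of D x"
  by (simp_all add: vertex_of_eq vertex_step)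

lemma f_neq: "x \<in> flags D \<Longrightarrow> f x \<noteq> x" "x \<in> flags D \<Longrightarrow> f x \<noteq> v x" "x \<in> flags D \<Longrightarrow> f x \<noteq> e x"
  using f_notin_face[of x] face_step[of x x] by auto

lemma face_of_gl:
  assumes "x \<in> flags D"
  shows "face_of D (gl x) = gl ` face_of D x"
proof -
  have sub: "face_of D (gl y) \<subseteq> gl ` face_of D y" if y: "y \<in> flags D" for y
  proof (rule face_of_minimal)
    fix z assume "z \<in> gl ` face_of D y"
    then obtain u where u: "u \<in> face_of D y" "z = gl u" by blast
    moreover have "u \<in> flags D" using u y face_flags by blast
    ultimately show "v z \<in> gl ` face_of D y \<and> e z \<in> gl ` face_of D y"
      using glv[of u] gle[of u] face_step[of u y] by (metis imageI)
  qed simp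
  have "gl ` face_of D x \<subseteq> gl ` gl ` face_of D (gl x)" using sub[of "gl x"] assms by auto
  then show ?thesis using sub[OF assms] by (auto simp: image_image)
qed

lemma polygon_face: "y \<in> face_of D x \<Longrightarrow> polygon D n y = polygon D n x"
  by (simp add: polygon_def face_of_eq)

lemma polygon_v [simp]: "polygon D n (v x) = polygon D n x"
  and polygon_e [simp]: "polygon D n (e x) = polygon D n x"
  by (simp_all add: polygon_def)

lemma polygon_gl: "x \<in> flags D \<Longrightarrow> polygon D n (gl x) = polygon D n x"
proof -
  have "inj gl" by (metis injI invol(4))
  then have "card (gl ` face_of D x) = card (face_of D x)" by (auto intro: card_image inj_on_subset)
  then show "x \<in> flags D \<Longrightarrow> polygon D n (gl x) = polygon D n x" by (simp add: polygon_def face_of_gl)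
qed

lemma bigons_flags: "x \<in> bigons D \<Longrightarrow> x \<in> flags D"
  by (simp add: bigons_def)

lemma bigons_step [simp]: "v x \<in> bigons D \<longleftrightarrow> x \<in> bigons D" "e x \<in> bigons D \<longleftrightarrow> x \<in> bigons D"
  "gl x \<in> bigons D \<longleftrightarrow> x \<in> bigons D"
  by (auto simp: bigons_def polygon_gl)

section \<open>Flag counts and Euler characteristics of single cells\<close>

lemma four_flags:
  assumes "x \<in> flags D"
  shows "card {x, e x, v x, e (v x)} = 4"
proof -
  have "e (v x) \<noteq> x" "e (v x) \<noteq> e x" "e (v x) \<noteq> v x" "x \<noteq> e x" "x \<noteq> v x" "e x \<noteq> v x"
    using assms v_neq[of x] e_neq[of x] e_neq[of "v x"] v_neq_e[of x] invol(2) in_flags by metis+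
  then show ?thesis by (simp add: card_insert_if)
qed

text \<open>A face with four flags has no room beyond the four distinct ones listed, and among them
  only \<open>e (v x)\<close> can equal \<open>v (e x)\<close>. Commutation of \<open>v\<close> and
  \<open>e\<close> is the working form of being a bigon; \<open>bigon_intro\<close> is the
  converse.\<close>

lemma bigon_face:
  assumes "x \<in> bigons D"
  shows "face_of D x = {x, e x, v x, e (v x)}" and "v (e x) = e (v x)"
proof -
  have x: "x \<in> flags D" "card (face_of D x) = 4" using assms by (simp_all add: bigons_def polygon_def)
  have "{x, e x, v x, e (v x)} \<subseteq> face_of D x" by (simp add: face_step)
  then show eq: "face_of D x = {x, e x, v x, e (v x)}"
    using card_subset_eq[OF finite_face[OF x(1)]] x(2) four_flags[OF x(1)] by metis
  have "v (e x) \<in> {x, e x, v x, e (v x)}" using eq face_step[of x x] face_step[of "e x" x] by auto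
  moreover have "v (e x) \<noteq> x" "v (e x) \<noteq> e x" "v (e x) \<noteq> v x"
    using x v_neq[of "e x"] e_neq[of x] v_neq_e[of x] invol(1) in_flags by metis+
  ultimately show "v (e x) = e (v x)" by auto
qed

lemma bigon_intro:
  assumes "x \<in> flags D" and "v (e x) = e (v x)"
  shows "x \<in> bigons D"
proof -
  have ve: "v (e (v x)) = e x" using assms(2) invol(1) by metis
  have "face_of D x = {x, e x, v x, e (v x)}"
  proof
    show "face_of D x \<subseteq> {x, e x, v x, e (v x)}"
      by (rule face_of_minimal) (use assms ve in auto)
  qed (auto simp: face_step)
  then show ?thesis using four_flags[OF assms(1)] assms(1) by (simp add: bigons_def polygon_def)
qed

text \<open>Two involutions without fixed points that satisfy \<open>(a b)^3 = 1\<close> have orbits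
  of size 2 or 6, and \<open>a y \<noteq> b y\<close> excludes 2. With \<open>v, e\<close> this
  counts the flags of a triangle, with \<open>e, f\<close> those of a vertex of degree 3.\<close>

lemma dihedral_card:
  assumes x: "x \<in> c" and c: "\<And>y. y \<in> c \<Longrightarrow> a y \<in> c \<and> b y \<in> c \<and> a (a y) = y \<and> b (b y) = y
      \<and> a y \<noteq> y \<and> b y \<noteq> y \<and> a y \<noteq> b y"
    and braid: "a (b (a (b (a (b x))))) = x"
  shows "card (flag_orbit {a, b} x) = 6"
proof -
  have A: "a y \<in> c" "a (a y) = y" "b y \<in> c" "b (b y) = y" if "y \<in> c" for y
    using c[OF that] by auto
  have N: "a y \<noteq> y" "b y \<noteq> y" "a y \<noteq> b y" if "y \<in> c" for y
    using c[OF that] by auto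
  have ja: "a y = a z \<longleftrightarrow> y = z" and jb: "b y = b z \<longleftrightarrow> y = z" if "y \<in> c" "z \<in> c" for y z
    using A(2,4) that by metis+
  note m = x A(1)[OF x] A(3)[OF x] A(1)[OF A(3)[OF x]] A(3)[OF A(1)[OF x]] A(1)[OF A(3)[OF A(1)[OF x]]]
  let ?O = "{x, a x, b x, a (b x), b (a x), a (b (a x))}"
  have "b (a (b (a (b x)))) = a x" using braid A(2) m(4) A(1,3) by metis
  then have "a (b (a (b x))) = b (a x)" using A(4) m(4) A(1,3) by metis
  then have bab: "b (a (b x)) = a (b (a x))" using A(2) m(4) A(1,3) by metis
  then have baba: "b (a (b (a x))) = a (b x)" using A(4) m(4) by metis
  have "flag_orbit {a, b} x = ?O"
  proof
    show "flag_orbit {a, b} x \<subseteq> ?O"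
    proof (rule flag_orbit_subset)
      fix y h assume "y \<in> ?O" "h \<in> {a, b}"
      then show "h y \<in> ?O" using A(2,4) m bab baba by (elim insertE emptyE) simp_all
    qed simp
    have "a y \<in> flag_orbit {a, b} x \<and> b y \<in> flag_orbit {a, b} x" if "y \<in> flag_orbit {a, b} x" for y
      using that flag_orbit_step[of y "{a, b}" x] by blast
    then show "?O \<subseteq> flag_orbit {a, b} x" by simp
  qed
  moreover have ne: "a (b x) \<noteq> x" "b (a x) \<noteq> x" "a (b (a x)) \<noteq> x"
    using N[OF m(1)] N[OF m(2)] A(2,4) m by metis+
  moreover have ne': "a (b (a x)) \<noteq> b x" "a (b x) \<noteq> b (a x)" "a (b (a x)) \<noteq> a x"
    using bab jb[OF m(4) m(1)] ja[OF m(5) m(1)] A(2,4) m N[OF m(1)] by metis+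
  ultimately show ?thesis
    using m ne[THEN not_sym] ne'[THEN not_sym] by (simp add: N N[THEN not_sym] card_insert_if ja jb)
qed

lemma triangle_intro:
  assumes "x \<in> flags D" and "v (e (v (e (v (e x))))) = x"
  shows "polygon D 3 x"
  using dihedral_card[of x "flags D" v e] assms v_neq e_neq v_neq_e
  by (simp add: polygon_def face_of_def)

lemma edge_card:
  assumes x: "x \<in> flags D"
  shows "card (edge_of D x) = 4"
proof -
  have "edge_of D x = {x, v x, f x, f (v x)}"
  proof
    show "edge_of D x \<subseteq> {x, v x, f x, f (v x)}"
      unfolding edge_of_def by (rule flag_orbit_subset) (use x vf[of x] vf[of "v x"] in auto)
    show "{x, v x, f x, f (v x)} \<subseteq> edge_of D x" by (auto simp: edge_step)
  qed
  moreover have "f (v x) \<noteq> x" "f (v x) \<noteq> v x" "f (v x) \<noteq> f x" "x \<noteq> v x" "x \<noteq> f x" "v x \<noteq> f x"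
    using x f_neq[of x] f_neq[of "v x"] v_neq[of x] invol(3) in_flags by metis+
  ultimately show ?thesis by (simp add: card_insert_if)
qed

lemma edges_of_cell: "x \<in> flags D \<Longrightarrow> 4 * card (edge_of D ` cell_of D x) = card (cell_of D x)"
proof (rule card_classes)
  fix y assume "x \<in> flags D" "y \<in> cell_of D x"
  then show "edge_of D y \<subseteq> cell_of D x" "card (edge_of D y) = 4"
    using edge_sub[of y] cell_of_eq[of y x] cell_flags[of x] edge_card[of y] by auto
qed (auto simp: finite_cell edge_of_eq)

lemma faces_of:
  assumes "x \<in> flags D" and "c \<subseteq> cell_of D x"
    and "\<And>y. y \<in> c \<Longrightarrow> v y \<in> c \<and> e y \<in> c" and "\<And>y. y \<in> c \<Longrightarrow> polygon D n y"
  shows "2 * n * card (face_of D ` c) = card c"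
proof (rule card_classes)
  show "finite c" using assms(1,2) finite_cell finite_subset by blast
  show "face_of D y \<subseteq> c" if "y \<in> c" for y using that assms(3) by (rule face_of_minimal)
qed (use assms(4) in \<open>auto simp: polygon_def face_of_eq\<close>)

text \<open>Dividing 24 by 6, 4 and 6 gives 4 vertices, 6 edges and 4 triangles, and 4 + 4 = 6 +
  2.\<close>

lemma euler_24_flags:
  assumes x: "x \<in> flags D" and card: "card (cell_of D x) = 24"
    and ve: "\<And>y. y \<in> cell_of D x \<Longrightarrow> v (e (v (e (v (e y))))) = y"
    and ef: "\<And>y. y \<in> cell_of D x \<Longrightarrow> e (f (e (f (e (f y))))) = y"
  shows "euler D x"
proof -
  have c: "y \<in> flags D" if "y \<in> cell_of D x" for y using that x cell_flags by blast
  have "6 * card (vertex_of D ` cell_of D x) = card (cell_of D x)"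
  proof (rule card_classes)
    fix y assume y: "y \<in> cell_of D x"
    show "vertex_of D y \<subseteq> cell_of D x" using y vertex_sub cell_of_eq by blast
    show "card (vertex_of D y) = 6"
      unfolding vertex_of_def
      by (rule dihedral_card[of _ "flags D"]) (use y c ef[OF y] e_neq f_neq in \<open>force+\<close>)
  qed (auto simp: x finite_cell vertex_of_eq)
  moreover have "2 * 3 * card (face_of D ` cell_of D x) = card (cell_of D x)"
    by (rule faces_of[OF x]) (use c ve in \<open>auto simp: cell_step intro: triangle_intro\<close>)
  ultimately show ?thesis using card edges_of_cell[OF x] by (simp add: euler_def)
qed

text \<open>In a cell of bigons \<open>v\<close> commutes with \<open>e\<close> and
  \<open>f\<close>, so it carries vertices to vertices, and the only vertices are those of
  \<open>x\<close> and \<open>v x\<close>; the corner condition in \<open>incidence\<close> keeps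
  them apart. Bigons and edges both have four flags, hence are equally many.\<close>

lemma football_euler:
  assumes x: "x \<in> flags D" and c: "cell_of D x \<subseteq> bigons D"
  shows "euler D x"
proof -
  have ve: "v (e y) = e (v y)" if "y \<in> cell_of D x" for y using that c bigon_face by blast
  have cf: "y \<in> flags D" if "y \<in> cell_of D x" for y using that x cell_flags by blast
  have swap: "v y \<in> vertex_of D (v z)" if "y \<in> vertex_of D z" "z \<in> cell_of D x" for y z
  proof -
    have "vertex_of D z \<subseteq> {y \<in> cell_of D x. v y \<in> vertex_of D (v z)}"
      by (rule vertex_of_minimal) (use that ve cf vf in \<open>auto simp: cell_step vertex_step\<close>)
    then show ?thesis using that by blast
  qed
  have "cell_of D x \<subseteq> {y \<in> cell_of D x. y \<in> vertex_of D x \<or> y \<in> vertex_of D (v x)}"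
    by (rule cell_of_minimal) (auto simp: cell_step vertex_step dest: swap)
  then have "vertex_of D ` cell_of D x = {vertex_of D x, vertex_of D (v x)}"
    using vertex_of_eq cell_step(1)[of x x] by (auto; blast)
  moreover have "v x \<notin> vertex_of D x"
    using vertex_Int_face[OF x, of "v x"] face_step[of x x] v_neq v_neq_e x by auto
  then have "vertex_of D x \<noteq> vertex_of D (v x)" using self_in(4) by blast
  ultimately have V: "card (vertex_of D ` cell_of D x) = 2" by simp
  have "2 * 2 * card (face_of D ` cell_of D x) = card (cell_of D x)"
    by (rule faces_of[OF x]) (use c in \<open>auto simp: cell_step bigons_def\<close>)
  then show ?thesis using V edges_of_cell[OF x] by (simp add: euler_def)
qed

end

section \<open>Removing bigons\<close>

text \<open>Serves twice: with \<open>R\<close> the two sides of the bigon being flattened, and with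
  \<open>R\<close> all bigons, in which case \<open>f'\<close> is \<open>across D\<close>.\<close>

locale bigon_removal = flag_complex +
  fixes R :: "'a set"
  assumes R_bigons: "R \<subseteq> bigons D" and R_closed: "x \<in> R \<Longrightarrow> v x \<in> R \<and> e x \<in> R"
begin

abbreviation "f' \<equiv> bypass R f e"

lemma R_iff [simp]: "v x \<in> R \<longleftrightarrow> x \<in> R" "e x \<in> R \<longleftrightarrow> x \<in> R"
  using R_closed invol by metis+

sublocale bp: bypassing "flags D" R f e
  by unfold_locales (auto simp: finite_flags)

lemma f'_commute: "x \<in> flags D - R \<Longrightarrow> f' (v x) = v (f' x)"
  by (rule bp.bypass_commute) (use vf R_bigons bigon_face in auto)

text \<open>Every flag of the cell of \<open>y\<close> lies on a chain through \<open>R\<close>, both ends of which are reached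
  from \<open>y\<close> without entering \<open>R\<close>.\<close>

lemma orbit_chain:
  assumes y: "y \<in> flags D - R" and A: "A \<subseteq> {v}" and z: "z \<in> flag_orbit (insert e (insert f A)) y"
  shows "z \<in> flags D \<and> leaves R f e z \<and> leaves R f e (e z) \<and>
    exit R f e z \<in> flag_orbit (insert e (insert f' A)) y \<and>
    exit R f e (e z) \<in> flag_orbit (insert e (insert f' A)) y"
  using z
proof (induction rule: flag_orbit_induct)
  case base
  then show ?case using y by (auto simp: leaves.out intro: flag_orbit_step[of _ "insert e (insert f' A)"])
next
  case (step z h)
  let ?O = "flag_orbit (insert e (insert f' A)) y"
  have z: "z \<in> flags D" using step.IH by blast
  have O: "e u \<in> ?O" "f' u \<in> ?O" if "u \<in> ?O" for u using that by (auto intro: flag_orbit_step)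
  consider "h = e" | "h = v" "v \<in> A" | "h = f" using step.hyps A by blast
  then show ?case
  proof cases
    case 1
    then show ?thesis using step.IH by simp
  next
    case 2
    have comm: "leaves R f e (v u) \<and> exit R f e (v u) = v (exit R f e u)"
      if "u \<in> flags D" "leaves R f e u" for u
      by (rule exit_commute[where S = "flags D"]) (use that vf R_bigons bigon_face in auto)
    have O': "v u \<in> ?O" if "u \<in> ?O" for u using that 2 by (auto intro: flag_orbit_step)
    show ?thesis
    proof (cases "z \<in> R")
      case True
      then have "e (v z) = v (e z)" using R_bigons bigon_face by auto
      then show ?thesis using 2 step.IH comm[of z] comm[of "e z"] O' by auto
    next
      case False
      then show ?thesis using 2 step.IH O' O by (auto simp: leaves.out)
    qed
  next
    case 3
    have fz: "leaves R f e (f z) \<and> exit R f e (f z) \<in> ?O"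
    proof (cases "z \<in> R")
      case True
      \<comment> \<open>Since \<open>f (e (e z)) = f z\<close>, the flag \<open>f z\<close> comes
        next on the chain that starts at \<open>e z\<close>.\<close>
      then have "leaves R f e (f z)"
        using step.IH leaves.cases[of R f e "e z"] by auto
      then have "exit R f e (e z) = exit R f e (f z)" using exit_into[of "e z" R f e] True by simp
      then show ?thesis using step.IH \<open>leaves R f e (f z)\<close> by simp
    next
      case False
      then have "leaves R f e (f z)" using z bp.leaves_first by blast
      moreover have "f' z \<in> ?O" using False step.IH O(2)[of z] by simp
      ultimately show ?thesis by (simp add: bypass_exit)
    qed
    have "leaves R f e (e (f z)) \<and> exit R f e (e (f z)) \<in> ?O"
    proof (cases "f z \<in> R")
      case True
      then have "leaves R f e (e (f z))" using leaves.into[of "e (f z)" R f e] step.IH by simp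
      moreover have "exit R f e (e (f z)) = exit R f e z"
        using True exit_into[of "e (f z)" R f e] step.IH by simp
      ultimately show ?thesis using step.IH by simp
    next
      case False
      then have "f z \<in> ?O" using fz by simp
      then show ?thesis using False O by (simp add: leaves.out)
    qed
    then show ?thesis using 3 fz z by simp
  qed
qed

text \<open>\<open>A\<close> is \<open>{v}\<close> for cells and empty for vertices. Edges have no
  analogue: their orbits do not use \<open>e\<close>, and flattening really merges them.\<close>

lemma orbit_bypass:
  assumes y: "y \<in> flags D - R" and A: "A \<subseteq> {v}"
  shows "flag_orbit (insert e (insert f' A)) y = flag_orbit (insert e (insert f A)) y - R"
proof
  let ?O = "flag_orbit (insert e (insert f A)) y"
  have O: "z \<in> flags D" if "z \<in> ?O" for z using that orbit_chain[OF y A] by blast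
  show "flag_orbit (insert e (insert f' A)) y \<subseteq> ?O - R"
  proof (rule flag_orbit_subset)
    fix z h assume z: "z \<in> ?O - R" and h: "h \<in> insert e (insert f' A)"
    have "f' z \<in> ?O - R"
      unfolding bypass_exit
      by (rule exit_closed[OF bp.leaves_first])
        (use z O in \<open>auto intro: flag_orbit_step[of _ "insert e (insert f A)"]\<close>)
    then show "h z \<in> ?O - R"
      using z h A by (auto intro: flag_orbit_step[of _ "insert e (insert f A)"])
  qed (use y in simp)
  show "?O - R \<subseteq> flag_orbit (insert e (insert f' A)) y"
    using orbit_chain[OF y A] by fastforce
qed

lemma cell_bypass: "y \<in> flags D - R \<Longrightarrow> flag_orbit {v, e, f'} y = cell_of D y - R"
  using orbit_bypass[of y "{v}"] by (simp add: cell_of_def insert_commute)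

lemma vertex_bypass: "y \<in> flags D - R \<Longrightarrow> flag_orbit {e, f'} y = vertex_of D y - R"
  using orbit_bypass[of y "{}"] by (simp add: vertex_of_def)

text \<open>The chain through \<open>z\<close> consists of \<open>e\<close> and \<open>f\<close>
  steps, hence stays at one vertex until it ends outside \<open>R\<close>. So deleting bigons loses
  no vertex of a cell that has other flags, and the vertices may be counted afterwards.\<close>

lemma vertex_remains:
  assumes "y \<in> flags D - R" and "z \<in> cell_of D y"
  shows "vertex_of D z - R \<noteq> {}"
proof -
  have "leaves R f e z"
    using orbit_chain[of y "{v}" z] assms by (simp add: cell_of_def insert_commute)
  then have "exit R f e z \<in> vertex_of D z - R" by (rule exit_closed) (auto simp: vertex_step)
  then show ?thesis by blast
qed

end

section \<open>Collapsible decompositions\<close>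

abbreviation across :: "'f cell_decomp \<Rightarrow> 'f \<Rightarrow> 'f" where
  "across D \<equiv> bypass (bigons D) (face_sw D) (edge_sw D)"

text \<open>The invariant of the flattening process.  \<open>F\<close> consists of the cells that are to be kept; the
  cells outside \<open>F\<close> are footballs (all 2-faces are bigons) or become triangular pillows when all
  their bigons are flattened.\<close>

locale collapsible = flag_complex D for D :: "'f cell_decomp" +
  fixes F :: "'f set"
  assumes F_flags: "F \<subseteq> flags D"
    and F_closed: "x \<in> F \<Longrightarrow> vertex_sw D x \<in> F \<and> edge_sw D x \<in> F \<and> face_sw D x \<in> F"
    and F_bigons: "x \<in> F \<Longrightarrow> x \<notin> bigons D"
    and F_euler: "x \<in> F \<Longrightarrow> euler D x"
    and purse: "x \<in> flags D - F - bigons D \<Longrightarrow>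
        polygon D 3 x \<and> across D x \<notin> face_of D x \<and> across D (edge_sw D x) = edge_sw D (across D x)"
begin

sublocale big: bigon_removal D "bigons D"
  by unfold_locales auto

abbreviation "a \<equiv> across D"

lemma F_iff [simp]: "v x \<in> F \<longleftrightarrow> x \<in> F" "e x \<in> F \<longleftrightarrow> x \<in> F" "f x \<in> F \<longleftrightarrow> x \<in> F"
  using F_closed invol by metis+

lemma a_F: "x \<in> F \<Longrightarrow> a x = f x"
  using F_bigons by (simp add: bypass_exit)

lemma a_notin_F: "x \<in> flags D - bigons D \<Longrightarrow> a x \<in> F \<longleftrightarrow> x \<in> F"
  using big.bp.bypass_invol[of x] a_F[of x] a_F[of "a x"] F_iff(3) by metis

lemma a_in_cell: "x \<in> flags D - bigons D \<Longrightarrow> a x \<in> cell_of D x"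
  using big.cell_bypass[of x] flag_orbit_step[of x "{v, e, a}" x] by auto

text \<open>Chains of gluings starting off the bigons never meet one, because \<open>gl\<close>
  preserves the number of sides; on the remaining flags \<open>across\<close> is an involution.
  These are the chains in the \<open>glue\<close> of \<open>collapse\<close>.\<close>

sublocale chain: bypassing "flags D - bigons D" "flags D - F" gl a
proof
  fix x assume "x \<in> flags D - bigons D" "x \<in> flags D - F"
  then show "a x \<in> flags D - bigons D \<and> a x \<in> flags D - F" "a (a x) = x"
    using big.bp.bypass_in[of x] big.bp.bypass_invol[of x] a_notin_F by blast+
qed (use finite_flags in auto)

lemma cell_F: "x \<in> F \<Longrightarrow> cell_of D x \<subseteq> F"
  by (rule cell_of_minimal) auto

lemma cell_not_F: "x \<in> flags D - F \<Longrightarrow> cell_of D x \<inter> F = {}"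
  using cell_F cell_of_eq self_in(1) by blast

lemma face_bigons: "y \<in> face_of D x \<Longrightarrow> x \<in> flags D \<Longrightarrow> y \<in> bigons D \<longleftrightarrow> x \<in> bigons D"
  using polygon_face[of y x 2] face_flags[of x] by (auto simp: bigons_def)

text \<open>Without its bigons the cell is a pair of triangles matched by \<open>across\<close>: 12
  flags, hence 3 vertices with 4 flags each. With b bigons it has 12 + 4b flags, so 3 + b edges and
  2 + b faces, and 3 + (2 + b) = (3 + b) + 2.\<close>

lemma purse_euler:
  assumes y: "y \<in> flags D - F - bigons D"
  shows "euler D y"
proof -
  define c where "c = cell_of D y"
  have cf: "c \<subseteq> flags D - F" using y cell_flags[of y] cell_not_F[of y] by (auto simp: c_def)
  have cell: "cell_of D z = c" if "z \<in> c" for z using that cell_of_eq by (simp add: c_def)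
  have pz: "polygon D 3 z" "a z \<notin> face_of D z" "a (e z) = e (a z)" "a (v z) = v (a z)" "a z \<in> c - bigons D"
    if "z \<in> c - bigons D" for z
  proof -
    have z: "z \<in> flags D - F - bigons D" using that cf by blast
    then show "polygon D 3 z" "a z \<notin> face_of D z" "a (e z) = e (a z)" using purse by blast+
    show "a (v z) = v (a z)" by (rule big.f'_commute) (use z in blast)
    show "a z \<in> c - bigons D" using big.bp.bypass_in[of z] a_in_cell[of z] z cell[of z] that by blast
  qed
  have invol': "a (a z) = z" if "z \<in> c - bigons D" for z
    using big.bp.bypass_invol[of z] that cf by blast
  have faces: "face_of D z \<subseteq> c - bigons D" if "z \<in> c - bigons D" for z
    by (rule face_of_minimal) (use that in \<open>auto simp: c_def cell_step\<close>)
  have yc: "y \<in> c - bigons D" using y by (simp add: c_def)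
  have a_face: "a z \<in> face_of D (a u)" if "z \<in> face_of D u" "u \<in> c - bigons D" for z u
  proof -
    have "face_of D u \<subseteq> {z \<in> c - bigons D. a z \<in> face_of D (a u)}"
    proof (rule face_of_minimal)
      fix z assume "z \<in> {z \<in> c - bigons D. a z \<in> face_of D (a u)}"
      then show "v z \<in> {z \<in> c - bigons D. a z \<in> face_of D (a u)} \<and>
          e z \<in> {z \<in> c - bigons D. a z \<in> face_of D (a u)}"
        using pz(3,4)[of z] face_step[of "a z" "a u"] by (auto simp: c_def cell_step)
    qed (use that in simp)
    then show ?thesis using that by blast
  qed
  have "flag_orbit {v, e, a} y \<subseteq> face_of D y \<union> face_of D (a y)"
  proof (rule flag_orbit_subset)
    fix z h assume z: "z \<in> face_of D y \<union> face_of D (a y)" and h: "h \<in> {v, e, a}"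
    have "a z \<in> face_of D y \<union> face_of D (a y)"
      using z a_face[of z y] a_face[of z "a y"] yc pz(5)[OF yc] invol'[OF yc] by auto
    then show "h z \<in> face_of D y \<union> face_of D (a y)" using z h by (auto simp: face_step)
  qed simp
  then have "c - bigons D \<subseteq> face_of D y \<union> face_of D (a y)"
    using big.cell_bypass[of y] y by (simp add: c_def)
  then have cc: "c - bigons D = face_of D y \<union> face_of D (a y)"
    using faces[OF yc] faces[OF pz(5)[OF yc]] by blast
  have fc: "finite c" using cf finite_flags finite_subset by blast
  have "face_of D y \<inter> face_of D (a y) = {}"
    using pz(2)[OF yc] face_of_eq self_in(2) by blast
  then have "card (c - bigons D) = card (face_of D y) + card (face_of D (a y))"
    unfolding cc using fc faces[OF yc] faces[OF pz(5)[OF yc]]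
    by (intro card_Un_disjoint) (auto intro: finite_subset)
  then have card12: "card (c - bigons D) = 12"
    using pz(1)[OF yc] pz(1)[OF pz(5)[OF yc]] by (simp add: polygon_def)
  have E: "4 * card (edge_of D ` c) = card c"
    using edges_of_cell[of y] y by (simp add: c_def)
  have F1: "2 * 2 * card (face_of D ` (c \<inter> bigons D)) = card (c \<inter> bigons D)"
    by (rule faces_of[of y]) (use y in \<open>auto simp: c_def cell_step bigons_def\<close>)
  have F2: "2 * 3 * card (face_of D ` (c - bigons D)) = card (c - bigons D)"
  proof (rule faces_of[of y])
    show "v z \<in> c - bigons D \<and> e z \<in> c - bigons D" if "z \<in> c - bigons D" for z
      using that by (auto simp: c_def cell_step)
  qed (use y pz(1) in \<open>auto simp: c_def\<close>)
  have "face_of D z \<noteq> face_of D u" if "z \<in> c \<inter> bigons D" "u \<in> c - bigons D" for z u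
    using that face_bigons[of z u] cf self_in(2)[of z] by blast
  then have disj: "face_of D ` (c \<inter> bigons D) \<inter> face_of D ` (c - bigons D) = {}" by blast
  have "face_of D ` c = face_of D ` (c \<inter> bigons D) \<union> face_of D ` (c - bigons D)" by blast
  then have Fs: "card (face_of D ` c) = card (face_of D ` (c \<inter> bigons D)) + card (face_of D ` (c - bigons D))"
    using card_Un_disjoint[OF _ _ disj] fc by simp
  have cards: "card c = card (c \<inter> bigons D) + card (c - bigons D)"
    using fc by (simp add: card_Int_Diff)
  let ?P = "\<lambda>z. vertex_of D z - bigons D"
  \<comment> \<open>\<open>?P\<close> is a vertex stripped of its bigon flags: what remains is one
    corner on each of the two triangles.\<close>
  have "4 * card (?P ` (c - bigons D)) = card (c - bigons D)"
  proof (rule card_classes)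
    fix z assume z: "z \<in> c - bigons D"
    have "vertex_of D z \<subseteq> c" using vertex_sub[of z] cell[of z] z by blast
    then show "?P z \<subseteq> c - bigons D" by blast
    show "?P u = ?P z" if "u \<in> ?P z" for u using that vertex_of_eq by blast
    have zf: "z \<in> flags D - bigons D" using z cf by blast
    have "?P z = {z, e z, a z, e (a z)}"
      unfolding big.vertex_bypass[OF zf, symmetric]
    proof
      show "flag_orbit {e, a} z \<subseteq> {z, e z, a z, e (a z)}"
        by (rule flag_orbit_subset)
          (use pz(3)[OF z] pz(3)[OF pz(5)[OF z]] invol'[OF z] in auto)
      have "e u \<in> flag_orbit {e, a} z \<and> a u \<in> flag_orbit {e, a} z" if "u \<in> flag_orbit {e, a} z" for u
        using that flag_orbit_step[of u "{e, a}" z] by blast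
      then show "{z, e z, a z, e (a z)} \<subseteq> flag_orbit {e, a} z" by simp
    qed
    moreover have "a z \<noteq> z" "a z \<noteq> e z" using pz(2)[OF z] face_step(2)[of z z] by auto
    moreover have "e (a z) \<noteq> z" "e (a z) \<noteq> e z" "e (a z) \<noteq> a z" "e z \<noteq> z"
      using \<open>a z \<noteq> z\<close> \<open>a z \<noteq> e z\<close> invol(2) e_neq[of z] e_neq[of "a z"] zf big.bp.bypass_in[OF zf] by (metis DiffD1)+
    ultimately show "card (?P z) = 4" by (simp add: card_insert_if eq_commute)
  qed (use fc in auto)
  \<comment> \<open>Stripping loses no vertex, as each keeps a flag off the bigons, and merges none,
    as vertices are equal or disjoint.\<close>
  moreover have "?P ` (c - bigons D) = (\<lambda>V. V - bigons D) ` vertex_of D ` c"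
  proof -
    have "?P z \<in> ?P ` (c - bigons D)" if z: "z \<in> c" for z
    proof -
      obtain u where u: "u \<in> vertex_of D z - bigons D"
        using big.vertex_remains[of y z] z y by (auto simp: c_def)
      then have "u \<in> c" using vertex_sub[of z] cell[OF z] by blast
      then show ?thesis using u vertex_of_eq[of u z] by (metis DiffD1 DiffD2 DiffI image_eqI)
    qed
    then show ?thesis by (auto simp: image_image)
  qed
  moreover have "inj_on (\<lambda>V. V - bigons D) (vertex_of D ` c)"
  proof (rule inj_onI)
    fix V V' assume V: "V \<in> vertex_of D ` c" "V' \<in> vertex_of D ` c" and eq: "V - bigons D = V' - bigons D"
    obtain z z' where z: "z \<in> c" "V = vertex_of D z" "z' \<in> c" "V' = vertex_of D z'" using V by blast
    obtain u where "u \<in> V - bigons D"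
      using big.vertex_remains[of y z] z y by (auto simp: c_def)
    then have "u \<in> vertex_of D z" "u \<in> vertex_of D z'" using eq z by auto
    then show "V = V'" using vertex_of_eq[of u z] vertex_of_eq[of u z'] z by simp
  qed
  ultimately have "4 * card (vertex_of D ` c) = card (c - bigons D)"
    by (simp add: card_image)
  then have "card (vertex_of D ` c) + card (face_of D ` c) = card (edge_of D ` c) + 2"
    using E F1 F2 Fs cards card12 by simp
  then show ?thesis by (simp add: euler_def c_def)
qed

lemma cell_decomposition: "cell_decomposition D"
proof -
  have "euler D x" if x: "x \<in> flags D" for x
  proof (cases "x \<in> F \<or> cell_of D x \<subseteq> bigons D")
    case True
    then show ?thesis using F_euler football_euler x by blast
  next
    case False
    then obtain y where y: "y \<in> cell_of D x" "y \<notin> bigons D" by blast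
    then have "y \<in> flags D - F - bigons D" using False x cell_not_F[of x] cell_flags[of x] by blast
    then have "euler D y" by (rule purse_euler)
    then show ?thesis using cell_of_eq[OF y(1)] by (simp add: euler_def)
  qed
  then show ?thesis using flag_complex_axioms by (simp add: cell_decomposition_iff)
qed

end

text \<open>The set of kept flags is a parameter instead of being recomputed from
  \<open>tetrahedron\<close>, so that the target stays one fixed record while \<open>D\<close>
  shrinks.\<close>

definition collapse :: "'f cell_decomp \<Rightarrow> 'f set \<Rightarrow> 'f cell_decomp" where
  "collapse D F =
    \<lparr> flags = F,
      vertex_sw = identity_off F (vertex_sw D),
      edge_sw = identity_off F (edge_sw D),
      face_sw = identity_off F (face_sw D),
      glue = identity_off F (bypass (flags D - F) (glue D) (across D)) \<rparr>"

lemma flatten_non_tetrahedra_eq: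
  "flatten_non_tetrahedra D = collapse D {x \<in> flags D. tetrahedron D x}"
  by (simp add: flatten_non_tetrahedra_def collapse_def bigons_def Let_def)

lemma (in collapsible) collapse_all:
  assumes "F = flags D"
  shows "collapse D F = D"
proof -
  have id: "identity_off (flags D) h = h" if "h \<in> {v, e, f, gl}" for h
    using switches[OF that] identity_off_permuted by blast
  have "bypass {} gl a = gl" by (simp add: bypass_exit fun_eq_iff)
  then show ?thesis using assms id by (simp add: collapse_def)
qed

lemma identity_off_identity_off: "F \<subseteq> G \<Longrightarrow> identity_off F (identity_off G h) = identity_off F h"
  by (auto simp: identity_off_def fun_eq_iff)

lemma identity_off_cong: "(\<And>x. x \<in> F \<Longrightarrow> h x = h' x) \<Longrightarrow> identity_off F h = identity_off F h'"
  by (auto simp: identity_off_def fun_eq_iff)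

section \<open>Flattening a bigon\<close>

definition remove_bigons :: "'f cell_decomp \<Rightarrow> 'f set \<Rightarrow> 'f cell_decomp" where
  "remove_bigons D R =
     (let G = flags D - R
      in \<lparr> flags = G,
           vertex_sw = identity_off G (vertex_sw D),
           edge_sw = identity_off G (edge_sw D),
           face_sw = identity_off G (bypass R (face_sw D) (edge_sw D)),
           glue = identity_off G (glue D) \<rparr>)"

lemma flatten_bigon_eq: "flatten_bigon D x = remove_bigons D (face_of D x \<union> face_of D (glue D x))"
  by (simp add: flatten_bigon_def remove_bigons_def Let_def)

text \<open>\<open>no_monogon\<close> excludes the degenerate outcome in which a surviving bigon
  becomes its own neighbour. For the other faces this is proved in
  \<open>f'_notin_face\<close>.\<close>

locale bigon_flattening = collapsible D F + bigon_removal D R for D :: "'f cell_decomp" and F R +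
  assumes R_gl: "x \<in> R \<Longrightarrow> glue D x \<in> R"
    and no_monogon: "x \<in> bigons D - R \<Longrightarrow> bypass R (face_sw D) (edge_sw D) x \<notin> face_of D x"
begin

abbreviation "D' \<equiv> remove_bigons D R"
abbreviation "G \<equiv> flags D - R"

lemma D'_simps [simp]: "flags D' = G" "vertex_sw D' = identity_off G v" "edge_sw D' = identity_off G e"
  "face_sw D' = identity_off G f'" "glue D' = identity_off G gl"
  by (simp_all add: remove_bigons_def Let_def)

lemma R_gl_iff [simp]: "gl x \<in> R \<longleftrightarrow> x \<in> R"
  using R_gl invol(4) by metis

lemma f'_in: "x \<in> G \<Longrightarrow> f' x \<in> G"
  by (rule bp.bypass_in)

lemma notin_R: "x \<notin> bigons D \<Longrightarrow> x \<notin> R"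
  using R_bigons by blast

lemma f'_F: "x \<in> F \<Longrightarrow> f' x = f x"
  using notin_R[of "f x"] F_bigons[of "f x"] by (simp add: bypass_exit)

lemma face_of_D': "x \<in> G \<Longrightarrow> face_of D' x = face_of D x"
  unfolding face_of_def by (rule flag_orbit_cong[where S = G]) auto

lemma cell_of_D': "x \<in> G \<Longrightarrow> cell_of D' x = cell_of D x - R"
proof -
  assume x: "x \<in> G"
  have "cell_of D' x = flag_orbit {v, e, f'} x"
    unfolding cell_of_def using flag_orbit_identity_off[OF x, of "{v, e, f'}"] f'_in by simp
  then show ?thesis using cell_bypass[OF x] by simp
qed

lemma vertex_of_D': "x \<in> G \<Longrightarrow> vertex_of D' x = vertex_of D x - R"
proof -
  assume x: "x \<in> G"
  have "vertex_of D' x = flag_orbit {e, f'} x"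
    unfolding vertex_of_def using flag_orbit_identity_off[OF x, of "{e, f'}"] f'_in by simp
  then show ?thesis using vertex_bypass[OF x] by simp
qed

lemma polygon_D': "x \<in> G \<Longrightarrow> polygon D' n x = polygon D n x"
  by (simp add: polygon_def face_of_D')

lemma bigons_D': "bigons D' = bigons D - R"
  using polygon_D' by (auto simp: bigons_def)

lemma F_G: "F \<subseteq> G"
  using F_flags F_bigons R_bigons by blast

lemma a_bypass: "x \<in> flags D - bigons D \<Longrightarrow> bypass (bigons D - R) f' e x = a x"
  by (rule big.bp.bypass_bypass[OF _ R_bigons])

lemma across_D':
  assumes x: "x \<in> G - bigons D"
  shows "across D' x = a x"
proof -
  interpret bypassing G "bigons D - R" f' e
    by unfold_locales (use finite_flags bp.bypass_invol f'_in in auto)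
  have "across D' x = bypass (bigons D - R) f' e x"
    by (rule bypass_cong) (use x in \<open>auto simp: bigons_D'\<close>)
  then show ?thesis using x a_bypass by simp
qed

text \<open>Kept cells do not change. A triangle outside \<open>F\<close> could become its own
  neighbour only if \<open>f' x\<close> were off the bigons as well; but then \<open>f' x\<close> is
  already the value of \<open>across\<close>, and \<open>purse\<close> applies.\<close>

lemma f'_notin_face:
  assumes x: "x \<in> G"
  shows "f' x \<notin> face_of D x"
proof (cases "x \<in> bigons D")
  case True
  then show ?thesis using x no_monogon by blast
next
  case nb: False
  show ?thesis
  proof (cases "x \<in> F \<or> f' x \<in> bigons D")
    case True
    then show ?thesis using f'_F f_notin_face F_flags face_bigons[of "f' x" x] nb x by auto
  next
    case False
    then have "f' x = a x" using a_bypass[of x] nb x by (simp add: bypass_exit[of "bigons D - R"])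
    then show ?thesis using purse False nb x by auto
  qed
qed

lemma flag_complex_D': "flag_complex D'"
proof
  show "finite (flags D')" using finite_flags by simp
next
  fix h assume "h \<in> {vertex_sw D', edge_sw D', face_sw D', glue D'}"
  then obtain h' where h': "h' \<in> {v, e, f', gl}" "h = identity_off G h'" by auto
  have "h' x \<in> G \<and> h' (h' x) = x" if "x \<in> G" for x
    using that h'(1) f'_in[OF that] bp.bypass_invol[OF that] by auto
  then show "h permutes flags D' \<and> (\<forall>x. h (h x) = x)"
    using h'(2) identity_off_permutes[of G h'] identity_off_invol[of G h'] by simp
next
  fix x assume "x \<in> flags D'"
  then have x: "x \<in> G" by simp
  have "vertex_of D' x \<inter> face_of D' x \<subseteq> {x, e x}"
    using x vertex_Int_face[of x] by (auto simp: vertex_of_D' face_of_D')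
  moreover have "f' x \<notin> face_of D' x" using x f'_notin_face face_of_D' by simp
  moreover have "gl x \<noteq> x \<longrightarrow> gl x \<notin> face_of D' x" using x gl_notin_face face_of_D' by simp
  ultimately show "vertex_sw D' x \<noteq> x \<and> edge_sw D' x \<noteq> x \<and> vertex_sw D' x \<noteq> edge_sw D' x \<and>
        vertex_sw D' (face_sw D' x) = face_sw D' (vertex_sw D' x) \<and>
        face_sw D' x \<notin> face_of D' x \<and>
        vertex_of D' x \<inter> face_of D' x \<subseteq> {x, edge_sw D' x} \<and>
        glue D' (vertex_sw D' x) = vertex_sw D' (glue D' x) \<and>
        glue D' (edge_sw D' x) = edge_sw D' (glue D' x) \<and>
        (glue D' x \<noteq> x \<longrightarrow> glue D' x \<notin> face_of D' x)"
    using x v_neq[of x] e_neq[of x] v_neq_e[of x] f'_commute[OF x] f'_in[OF x] glv[of x] gle[of x]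
    by simp
qed

lemma euler_D':
  assumes x: "x \<in> F"
  shows "euler D' x"
proof -
  have c: "cell_of D' x = cell_of D x" using x cell_of_D'[of x] F_G cell_F[OF x] by blast
  have "vertex_of D' y = vertex_of D y \<and> face_of D' y = face_of D y \<and> edge_of D' y = edge_of D y"
    if "y \<in> F" for y
  proof -
    have y: "y \<in> G" using that F_G by blast
    have "edge_of D' y = edge_of D y"
      unfolding edge_of_def by (rule flag_orbit_cong[where S = F]) (use that F_G f'_F in auto)
    then show ?thesis using vertex_of_D'[OF y] face_of_D'[OF y] vertex_sub[of y] cell_F[OF that] F_G by blast
  qed
  then have "vertex_of D' ` cell_of D x = vertex_of D ` cell_of D x"
    "face_of D' ` cell_of D x = face_of D ` cell_of D x"
    "edge_of D' ` cell_of D x = edge_of D ` cell_of D x"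
    using cell_F[OF x] by (auto intro!: image_cong)
  then show ?thesis using F_euler[OF x] c by (simp add: euler_def)
qed

lemma collapsible_D': "collapsible D' F"
proof (intro collapsible.intro collapsible_axioms.intro)
  show "flag_complex D'" by (rule flag_complex_D')
  show "F \<subseteq> flags D'" using F_G by simp
next
  fix x assume "x \<in> F"
  then show "vertex_sw D' x \<in> F \<and> edge_sw D' x \<in> F \<and> face_sw D' x \<in> F" "x \<notin> bigons D'" "euler D' x"
    using F_G F_bigons f'_F euler_D' by (auto simp: bigons_D')
next
  fix x assume "x \<in> flags D' - F - bigons D'"
  then have x: "x \<in> G" "x \<in> flags D - F - bigons D" "x \<in> G - bigons D" "e x \<in> G - bigons D"
    by (auto simp: bigons_D')
  moreover have "a x \<in> G" using big.bp.bypass_in[of x] x R_bigons by blast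
  ultimately show "polygon D' 3 x \<and> across D' x \<notin> face_of D' x \<and>
      across D' (edge_sw D' x) = edge_sw D' (across D' x)"
    using purse[of x] across_D'[of x] across_D'[of "e x"] by (simp add: polygon_D' face_of_D')
qed

lemma collapse_D': "collapse D' F = collapse D F"
proof -
  have "bypass (G - F) (identity_off G gl) (across D') x = bypass (flags D - F) gl a x" if "x \<in> F" for x
    by (rule chain.bypass_cong) (use that F_flags F_bigons notin_R across_D' in auto)
  then show ?thesis
    using F_G f'_F by (auto simp: collapse_def identity_off_identity_off intro: identity_off_cong)
qed

end

section \<open>Flattening a pillow\<close>

locale pillow_flattening = collapsible D F for D :: "'f cell_decomp" and F +
  fixes x n
  assumes x: "x \<in> flags D - F" and pillow: "pillow D n x" and n: "n = 2 \<or> n = 3"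
begin

abbreviation "R \<equiv> cell_of D x"
abbreviation "G \<equiv> flags D - R"
abbreviation "D' \<equiv> flatten_pillow D x"
abbreviation "gl' \<equiv> bypass R gl f"

lemma D'_simps [simp]: "flags D' = G" "vertex_sw D' = identity_off G v" "edge_sw D' = identity_off G e"
  "face_sw D' = identity_off G f" "glue D' = identity_off G gl'"
  by (simp_all add: flatten_pillow_def Let_def)

lemma R_flags: "R \<subseteq> flags D"
  using cell_flags x by blast

lemma R_iff [simp]: "v y \<in> R \<longleftrightarrow> y \<in> R" "e y \<in> R \<longleftrightarrow> y \<in> R" "f y \<in> R \<longleftrightarrow> y \<in> R"
  using cell_step invol by metis+

lemma fe: "y \<in> R \<Longrightarrow> f (e y) = e (f y)"
  using pillow by (simp add: pillow_def)

lemma R_faces: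
  assumes "y \<in> R"
  shows "R = face_of D y \<union> face_of D (f y)"
proof -
  have R: "R = face_of D x \<union> face_of D (f x)" using pillow by (simp add: pillow_def)
  have fy: "f y \<notin> face_of D y" "f y \<in> R" using f_notin_face assms R_flags by auto
  then consider "y \<in> face_of D x" "f y \<in> face_of D (f x)" | "y \<in> face_of D (f x)" "f y \<in> face_of D x"
    using assms R face_of_eq by blast
  then show ?thesis using R face_of_eq by cases auto
qed

lemma R_polygon: "y \<in> R \<Longrightarrow> polygon D n y"
  using R_faces[of x] pillow polygon_face by (auto simp: pillow_def)

lemma R_across:
  assumes "y \<in> R" "y \<notin> bigons D"
  shows "a y = f y"
proof -
  have "n = 3" using n R_polygon assms R_flags by (auto simp: bigons_def)
  then have "f y \<notin> bigons D" using R_polygon[of "f y"] assms(1) by (auto simp: bigons_def polygon_def)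
  then show ?thesis by (simp add: bypass_exit)
qed

sublocale bp: bypassing "flags D" R gl f
  by unfold_locales (use finite_flags in auto)

lemma gl'_in: "y \<in> G \<Longrightarrow> gl' y \<in> G"
  by (rule bp.bypass_in)

lemma face_G: "y \<in> G \<Longrightarrow> face_of D y \<subseteq> G"
  by (rule face_of_minimal) auto

text \<open>Let \<open>?z = gl y\<close> be on the pillow; the chain crosses to \<open>f ?z\<close>.
  If \<open>?u\<close> is outside the pillow, it is not on the face of \<open>y\<close>, which is
  glued to the face of \<open>?z\<close>. If \<open>?u\<close> is on the pillow, the only face
  available is that of \<open>f ?z\<close>; as no face is glued to itself, that face is a boundary,
  the chain turns back and \<open>y\<close> becomes a boundary flag.\<close>

lemma gl'_notin_face:
  assumes y: "y \<in> G" and neq: "gl' y \<noteq> y"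
  shows "gl' y \<notin> face_of D y"
proof (cases "gl y \<in> R")
  case False
  then show ?thesis using gl_notin_face y neq by (simp add: bypass_exit)
next
  case True
  let ?z = "gl y" and ?u = "gl (f (gl y))"
  have yf: "y \<in> flags D" using y by simp
  have l: "leaves R gl f ?u" using bp.leaves_first[OF y] True leaves.cases by metis
  then have g: "gl' y = exit R gl f ?u" using True by (simp add: bypass_exit exit_into)
  have fz: "f ?z \<in> R" "f ?z \<notin> face_of D ?z" using True f_notin_face yf by auto
  have fy: "face_of D y = gl ` face_of D ?z" using face_of_gl[of ?z] yf by simp
  show ?thesis
  proof (cases "?u \<in> R")
    case False
    have "?u \<notin> face_of D y" using fz(2) fy by (metis imageE invol(4))
    then show ?thesis using False g by simp
  next
    case u: True
    have "?u \<notin> face_of D ?z"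
    proof
      assume "?u \<in> face_of D ?z"
      then have "f ?z \<in> face_of D y" using fy by (metis imageI invol(4))
      then show False using face_G[OF y] fz(1) by blast
    qed
    then have "?u \<in> face_of D (f ?z)" using u R_faces[OF True] by blast
    then have "?u = f ?z" using gl_notin_face[of "f ?z"] yf by auto
    then have "gl (f ?u) = y" by simp
    moreover have "leaves R gl f y" using y by (simp add: leaves.out)
    ultimately have "gl' y = y" using g u y by (simp add: exit_into)
    then show ?thesis using neq by simp
  qed
qed

lemma gl'_v: "y \<in> G \<Longrightarrow> gl' (v y) = v (gl' y)"
  by (rule bp.bypass_commute) (use vf glv in auto)

lemma gl'_e: "y \<in> G \<Longrightarrow> gl' (e y) = e (gl' y)"
  by (rule bp.bypass_commute) (use fe gle in auto)

lemma orbits_D':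
  assumes "y \<in> G"
  shows "cell_of D' y = cell_of D y" "face_of D' y = face_of D y"
    "edge_of D' y = edge_of D y" "vertex_of D' y = vertex_of D y"
proof -
  have eq: "flag_orbit (identity_off G ` A) y = flag_orbit A y" if "A \<subseteq> {v, e, f}" for A
    using that by (intro flag_orbit_identity_off assms) auto
  show "cell_of D' y = cell_of D y"
    using eq[of "{v, e, f}"] by (simp add: cell_of_def[of D'] cell_of_def[of D, THEN fun_cong, of y])
  show "face_of D' y = face_of D y"
    using eq[of "{v, e}"] by (simp add: face_of_def[of D'] face_of_def[of D, THEN fun_cong, of y])
  show "edge_of D' y = edge_of D y"
    using eq[of "{v, f}"] by (simp add: edge_of_def[of D'] edge_of_def[of D, THEN fun_cong, of y])
  show "vertex_of D' y = vertex_of D y"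
    using eq[of "{e, f}"] by (simp add: vertex_of_def[of D'] vertex_of_def[of D, THEN fun_cong, of y])
qed

lemma polygon_D': "y \<in> G \<Longrightarrow> polygon D' k y = polygon D k y"
  by (simp add: polygon_def orbits_D')

lemma bigons_D': "bigons D' = bigons D - R"
  using polygon_D' by (auto simp: bigons_def)

lemma F_G: "F \<subseteq> G"
  using F_flags cell_not_F[OF x] by blast

lemma across_D':
  assumes y: "y \<in> G - bigons D"
  shows "across D' y = a y"
proof -
  interpret bypassing G "bigons D" f e
    by unfold_locales (use finite_flags in auto)
  show ?thesis by (rule bypass_cong) (use y in \<open>auto simp: bigons_D'\<close>)
qed

lemma a_G:
  assumes y: "y \<in> G - bigons D"
  shows "a y \<in> G - bigons D"
proof -
  have "a y \<notin> R"
  proof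
    assume "a y \<in> R"
    then have "cell_of D y = R" using a_in_cell[of y] y cell_of_eq[of "a y"] by auto
    then show False using y self_in(1)[of y] by blast
  qed
  then show ?thesis using big.bp.bypass_in[of y] y by auto
qed

lemma flag_complex_D': "flag_complex D'"
proof
  show "finite (flags D')" using finite_flags by simp
next
  fix h assume "h \<in> {vertex_sw D', edge_sw D', face_sw D', glue D'}"
  then obtain h' where h': "h' \<in> {v, e, f, gl'}" "h = identity_off G h'" by auto
  have "h' x \<in> G \<and> h' (h' x) = x" if "x \<in> G" for x
    using that h'(1) gl'_in[OF that] bp.bypass_invol[OF that] by auto
  then show "h permutes flags D' \<and> (\<forall>x. h (h x) = x)"
    using h'(2) identity_off_permutes[of G h'] identity_off_invol[of G h'] by simp
next
  fix y assume "y \<in> flags D'"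
  then have y: "y \<in> G" by simp
  have "vertex_of D' y \<inter> face_of D' y \<subseteq> {y, e y}"
    using y vertex_Int_face[of y] by (auto simp: orbits_D')
  then show "vertex_sw D' y \<noteq> y \<and> edge_sw D' y \<noteq> y \<and> vertex_sw D' y \<noteq> edge_sw D' y \<and>
        vertex_sw D' (face_sw D' y) = face_sw D' (vertex_sw D' y) \<and>
        face_sw D' y \<notin> face_of D' y \<and>
        vertex_of D' y \<inter> face_of D' y \<subseteq> {y, edge_sw D' y} \<and>
        glue D' (vertex_sw D' y) = vertex_sw D' (glue D' y) \<and>
        glue D' (edge_sw D' y) = edge_sw D' (glue D' y) \<and>
        (glue D' y \<noteq> y \<longrightarrow> glue D' y \<notin> face_of D' y)"
    using y v_neq[of y] e_neq[of y] v_neq_e[of y] vf[of y] f_notin_face[of y]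
      gl'_v[OF y] gl'_e[OF y] gl'_in[OF y] gl'_notin_face[OF y]
    by (simp add: orbits_D')
qed

lemma collapsible_D': "collapsible D' F"
proof (intro collapsible.intro collapsible_axioms.intro)
  show "flag_complex D'" by (rule flag_complex_D')
  show "F \<subseteq> flags D'" using F_G by simp
next
  fix y assume y: "y \<in> F"
  then show "vertex_sw D' y \<in> F \<and> edge_sw D' y \<in> F \<and> face_sw D' y \<in> F" "y \<notin> bigons D'"
    using F_G F_bigons by (auto simp: bigons_D')
  have "cell_of D y \<subseteq> G" using cell_F[OF y] F_G by blast
  then have "vertex_of D' ` cell_of D y = vertex_of D ` cell_of D y"
    "face_of D' ` cell_of D y = face_of D ` cell_of D y"
    "edge_of D' ` cell_of D y = edge_of D ` cell_of D y"
    using orbits_D' by (auto intro!: image_cong)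
  then show "euler D' y" using F_euler[OF y] orbits_D'(1)[of y] y F_G by (auto simp: euler_def)
next
  fix y assume "y \<in> flags D' - F - bigons D'"
  then have y: "y \<in> G" "y \<in> flags D - F - bigons D" "y \<in> G - bigons D" "e y \<in> G - bigons D"
    by (auto simp: bigons_D')
  moreover have "a y \<in> G" using a_G y by blast
  ultimately show "polygon D' 3 y \<and> across D' y \<notin> face_of D' y \<and>
      across D' (edge_sw D' y) = edge_sw D' (across D' y)"
    using purse[of y] across_D'[of y] across_D'[of "e y"] by (simp add: polygon_D' orbits_D')
qed

text \<open>The chains are skipped in two stages, first the pillow and then the rest. The operation
  crosses the pillow by \<open>f\<close>, the simultaneous flattening by \<open>across\<close>:
  these agree on a triangular pillow, and a bigonal one is never met by chains off the
  bigons.\<close>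

lemma collapse_D': "collapse D' F = collapse D F"
proof -
  have R_F: "R \<subseteq> flags D - F" using R_flags cell_not_F[OF x] by blast
  interpret r: bypassing "flags D - bigons D" R gl a
  proof
    fix y assume "y \<in> flags D - bigons D" "y \<in> R"
    then show "a y \<in> flags D - bigons D \<and> a y \<in> R" "a (a y) = y"
      using R_across[of y] big.bp.bypass_in[of y] big.bp.bypass_invol[of y] R_iff(3)[of y] by auto
  qed (use finite_flags in auto)
  let ?gl = "bypass R gl a"
  have gl: "gl' y = ?gl y" if "y \<in> G - bigons D" for y
    by (rule r.bypass_cong) (use that R_across in auto)
  interpret g: bypassing "G - bigons D" "flags D - F - R" ?gl a
  proof
    fix y assume y: "y \<in> G - bigons D"
    then show "?gl y \<in> G - bigons D" "?gl (?gl y) = y"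
      using r.bypass_in[of y] r.bypass_invol[of y] by auto
    assume "y \<in> flags D - F - R"
    then show "a y \<in> G - bigons D \<and> a y \<in> flags D - F - R" "a (a y) = y"
      using y a_G[OF y] a_notin_F[of y] big.bp.bypass_invol[of y] by auto
  qed (use finite_flags in auto)
  have "bypass (G - F) (identity_off G gl') (across D') y = bypass (flags D - F) gl a y" if "y \<in> F" for y
  proof -
    have y: "y \<in> G" "y \<notin> bigons D" using that F_G F_bigons by blast+
    have "bypass (G - F) (identity_off G gl') (across D') y = bypass (flags D - F - R) ?gl a y"
      by (rule g.bypass_cong) (use y that gl across_D' in auto)
    also have "\<dots> = bypass (flags D - F) gl a y"
      by (rule chain.bypass_bypass[OF _ R_F]) (use y that in auto)
    finally show ?thesis .
  qed
  then show ?thesis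
    using F_G by (auto simp: collapse_def identity_off_identity_off intro: identity_off_cong)
qed

end

section \<open>The sequence of operations\<close>

context collapsible
begin

lemma removal_of_bigon:
  assumes "x \<in> bigons D"
  shows "bigon_removal D (face_of D x \<union> face_of D (gl x))"
proof unfold_locales
  show "face_of D x \<union> face_of D (gl x) \<subseteq> bigons D"
    using assms face_bigons[of _ x] face_bigons[of _ "gl x"] bigons_flags by auto
qed (auto simp: face_step)

text \<open>Both \<open>f z\<close> and \<open>f (e z)\<close> must lie on the face that does not
  contain \<open>z\<close>, and at the same vertex; the corner condition then leaves only
  \<open>f (e z) = e (f z)\<close>.\<close>

lemma pillow_if_two_faces:
  assumes y: "y \<in> bigons D" and r: "r \<in> bigons D" and cell: "cell_of D y = face_of D y \<union> face_of D r"
  shows "pillow D 2 y"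
proof -
  have f_other: "f z \<in> face_of D u" if "z \<in> face_of D y" "face_of D u = face_of D r" for z u
    using that cell f_notin_face[of z] face_flags[of y] bigons_flags[OF y] face_sub[of y]
      cell_step(3)[of z y] face_of_eq[of z y] by blast
  have fr: "face_of D (f y) = face_of D r" using f_other[of y r] face_of_eq by simp
  have nf: "f z \<notin> face_of D z" if "z \<in> cell_of D y" for z
    using that cell_flags[OF bigons_flags[OF y]] f_notin_face by blast
  have fe: "f (e z) = e (f z)" if z: "z \<in> cell_of D y" for z
  proof -
    have zf: "f z \<in> flags D" using z cell_flags[OF bigons_flags[OF y]] by auto
    have "f (e z) \<notin> face_of D z" using nf[of "e z"] z by (simp add: cell_step)
    moreover have "f z \<notin> face_of D z" using nf z by simp
    moreover have "f (e z) \<in> cell_of D y" "f z \<in> cell_of D y" using z by (simp_all add: cell_step)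
    ultimately have "f (e z) \<in> face_of D (f z)" using z cell face_of_eq by blast
    moreover have "f (e z) \<in> vertex_of D (f z)" by (simp add: vertex_step)
    ultimately have "f (e z) = f z \<or> f (e z) = e (f z)" using vertex_Int_face[OF zf] by blast
    then show ?thesis using e_neq[of z] zf invol(3) in_flags(3) by metis
  qed
  have "face_of D y \<noteq> face_of D (f y)" using nf[of y] self_in(2)[of "f y"] by auto
  moreover have "polygon D 2 (f y)" using r fr by (simp add: bigons_def polygon_def)
  ultimately show ?thesis using y fr fe cell by (simp add: pillow_def bigons_def)
qed

text \<open>Flattening a bigon is obstructed only if it would leave a football with one bigon.  If that
  football was no pillow, it lost two bigons glued to each other.\<close>

lemma obstruction:
  assumes x: "x \<in> bigons D" and no_pillow: "\<And>y. y \<in> flags D \<Longrightarrow> \<not> pillow D 2 y"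
    and y: "y \<in> bigons D - (face_of D x \<union> face_of D (gl x))"
    and monogon: "bypass (face_of D x \<union> face_of D (gl x)) f e y \<in> face_of D y"
  shows "gl x \<noteq> x" and "cell_of D x = cell_of D y" and "cell_of D (gl x) = cell_of D y"
    and "cell_of D y = face_of D y \<union> face_of D x \<union> face_of D (gl x)"
proof -
  define R where "R = face_of D x \<union> face_of D (gl x)"
  interpret r: bigon_removal D R unfolding R_def using x by (rule removal_of_bigon)
  have yR: "y \<in> flags D - R" and yB: "y \<in> bigons D" using y bigons_flags by (auto simp: R_def)
  have face: "face_of D y = {y, e y, v y, v (e y)}" and ve: "v (e y) = e (v y)"
    using bigon_face[OF yB] by auto
  have "r.f' y \<in> vertex_of D y - R"
    using r.vertex_bypass[OF yR] flag_orbit_step[OF flag_orbit_refl, of "r.f'" "{e, r.f'}" y] by simp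
  moreover have "r.f' y \<noteq> y"
    by (rule r.bp.bypass_neq) (use yR f_neq e_neq in auto)
  \<comment> \<open>As \<open>f'\<close> keeps the vertex, a neighbour on the same face can only be
    the flag across the corner: the two edges of the bigon have become one.\<close>
  ultimately have "r.f' y = e y"
    using monogon vertex_Int_face[of y "r.f' y"] yR unfolding R_def by blast
  then have f': "r.f' z \<in> face_of D y" if "z \<in> {y, e y}" for z
    using that r.bp.bypass_invol[OF yR] by (auto simp: face)
  have f'v: "r.f' (v z) \<in> face_of D y" if "z \<in> {y, e y}" for z
    using f'[OF that] r.f'_commute[of z] that yR face_step by auto
  have "r.f' z \<in> face_of D y" if "z \<in> face_of D y" for z
    using that f'[of y] f'[of "e y"] f'v[of y] f'v[of "e y"] unfolding face by blast
  then have "flag_orbit {v, e, r.f'} y \<subseteq> face_of D y"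
    by (intro flag_orbit_subset self_in) (elim insertE emptyE; simp add: face_step)
  then have c: "cell_of D y \<subseteq> face_of D y \<union> R" using r.cell_bypass[OF yR] by blast
  have sub: "face_of D r \<subseteq> cell_of D y" if meet: "face_of D r \<inter> cell_of D y \<noteq> {}" for r
  proof -
    obtain z where "z \<in> face_of D r" "z \<in> cell_of D y" using meet by blast
    then show ?thesis using face_sub[of z] cell_of_eq[of z y] face_of_eq[of z r] by simp
  qed
  \<comment> \<open>If only one of the flattened sides belonged to this cell, the cell would be a
    bigonal pillow.\<close>
  have two: False if r: "r \<in> bigons D" "cell_of D y \<subseteq> face_of D y \<union> face_of D r" for r
  proof -
    have "f y \<in> face_of D r" using r(2) f_notin_face[of y] yR cell_step(3)[of y y] by auto
    then have "cell_of D y = face_of D y \<union> face_of D r"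
      using r(2) sub[of r] face_sub[of y] cell_step(3)[of y y] by auto
    then show False using pillow_if_two_faces[OF yB r(1)] no_pillow yR by blast
  qed
  have "face_of D x \<inter> cell_of D y \<noteq> {}" "face_of D (gl x) \<inter> cell_of D y \<noteq> {}"
    using two[of "gl x"] two[of x] c x unfolding R_def by auto
  then have s: "face_of D x \<subseteq> cell_of D y" "face_of D (gl x) \<subseteq> cell_of D y" using sub by blast+
  then show "cell_of D x = cell_of D y" "cell_of D (gl x) = cell_of D y"
    using cell_of_eq self_in(2) by blast+
  show "cell_of D y = face_of D y \<union> face_of D x \<union> face_of D (gl x)"
    using c s face_sub[of y] unfolding R_def by blast
  show "gl x \<noteq> x" using two[of x] c x unfolding R_def by auto
qed

lemma flattenable_bigon:
  assumes "bigons D \<noteq> {}" and no_pillow: "\<And>y. y \<in> flags D \<Longrightarrow> \<not> pillow D 2 y"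
  obtains x where "x \<in> bigons D"
    "\<And>y. y \<in> bigons D - (face_of D x \<union> face_of D (gl x)) \<Longrightarrow>
      bypass (face_of D x \<union> face_of D (gl x)) f e y \<notin> face_of D y"
proof -
  obtain x where x: "x \<in> bigons D" using assms(1) by blast
  show ?thesis
  proof (cases "\<exists>y \<in> bigons D - (face_of D x \<union> face_of D (gl x)).
      bypass (face_of D x \<union> face_of D (gl x)) f e y \<in> face_of D y")
    case False
    then show ?thesis using x that by blast
  next
    case True
    then obtain y where y: "y \<in> bigons D - (face_of D x \<union> face_of D (gl x))"
      "bypass (face_of D x \<union> face_of D (gl x)) f e y \<in> face_of D y" by blast
    note o = obstruction[OF x no_pillow y]
    have "bypass (face_of D y \<union> face_of D (gl y)) f e z \<notin> face_of D z"
      if z: "z \<in> bigons D - (face_of D y \<union> face_of D (gl y))" for z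
    proof
      assume m: "bypass (face_of D y \<union> face_of D (gl y)) f e z \<in> face_of D z"
      have yB: "y \<in> bigons D" using y by blast
      note o' = obstruction[OF yB no_pillow z m]
      have xf: "x \<in> flags D" "gl x \<in> flags D" "y \<in> flags D" using x yB bigons_flags by auto
      \<comment> \<open>If \<open>y\<close> were obstructed too, \<open>gl y\<close> would lie in
        the same cell on another face, so on that of \<open>x\<close> or \<open>gl x\<close>; but
        those two are glued to each other.\<close>
      have "gl y \<in> cell_of D y" using o'(2,3) self_in(1) by metis
      moreover have "gl y \<notin> face_of D y" using gl_notin_face o'(1) xf by blast
      ultimately have "gl y \<in> face_of D x \<or> gl y \<in> face_of D (gl x)" using o(4) by blast
      then have "y \<in> face_of D (gl x) \<or> y \<in> face_of D x"
        using face_of_gl[OF xf(1)] face_of_gl[OF xf(2)] invol(4) by (metis imageI)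
      then show False using y by blast
    qed
    then show ?thesis using y that by blast
  qed
qed

lemma atomic_step:
  assumes "F \<noteq> flags D"
  obtains D' where "atomic_operation D D'" "collapsible D' F" "collapse D' F = collapse D F"
    "card (flags D') < card (flags D)"
proof (cases "(\<exists>x \<in> flags D. pillow D 2 x) \<or> bigons D = {}")
  case True
  obtain x n where xn: "x \<in> flags D - F" "pillow D n x" "n = 2 \<or> n = 3"
  proof (cases "bigons D = {}")
    case False
    then obtain x where "x \<in> flags D" "pillow D 2 x" using True by blast
    moreover then have "x \<in> bigons D" by (simp add: pillow_def bigons_def)
    ultimately show ?thesis using that[of x 2] F_bigons by blast
  next
    case True
    obtain x where x: "x \<in> flags D - F" using assms F_flags by blast
    \<comment> \<open>Without bigons \<open>across\<close> is the plain face switch, and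
      \<open>purse\<close> turns into the conditions for a triangular pillow.\<close>
    have a: "a = f" using True by (simp add: bypass_exit fun_eq_iff)
    have p: "polygon D 3 y" "f y \<notin> face_of D y" "f (e y) = e (f y)" if "y \<in> cell_of D x" for y
      using purse[of y] that cell_not_F[OF x] cell_flags[of x] x True a by auto
    have swap: "f y \<in> face_of D (f z)" if "y \<in> face_of D z" "z \<in> cell_of D x" for y z
    proof -
      have "face_of D z \<subseteq> {y \<in> cell_of D x. f y \<in> face_of D (f z)}"
      proof (rule face_of_minimal)
        fix y assume y: "y \<in> {y \<in> cell_of D x. f y \<in> face_of D (f z)}"
        then have "y \<in> flags D" using cell_flags[of x] x by blast
        then show "v y \<in> {y \<in> cell_of D x. f y \<in> face_of D (f z)} \<and>
            e y \<in> {y \<in> cell_of D x. f y \<in> face_of D (f z)}"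
          using y p(3)[of y] vf[of y] face_step[of "f y" "f z"] by (auto simp: cell_step)
      qed (use that in simp)
      then show ?thesis using that by blast
    qed
    have "cell_of D x \<subseteq> {y \<in> cell_of D x. y \<in> face_of D x \<or> y \<in> face_of D (f x)}"
      by (rule cell_of_minimal) (use swap[of _ x] swap[of _ "f x"] in \<open>auto simp: cell_step face_step\<close>)
    then have "cell_of D x = face_of D x \<union> face_of D (f x)"
      using face_sub[of x] face_sub[of "f x"] by auto
    moreover have "face_of D x \<noteq> face_of D (f x)" using p(2)[of x] self_in(2)[of "f x"] by auto
    ultimately have "pillow D 3 x" using p by (simp add: pillow_def cell_step)
    then show ?thesis using that x by blast
  qed
  interpret pillow_flattening D F x n by unfold_locales (use xn in auto)
  have "atomic_operation D D'"
    using xn cell_decomposition collapsible.cell_decomposition[OF collapsible_D']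
    unfolding atomic_operation_def by blast
  moreover have "flags D' \<subset> flags D" using xn(1) self_in(1)[of x] by (simp only: D'_simps) blast
  then have "card (flags D') < card (flags D)" using finite_flags psubset_card_mono by blast
  ultimately show ?thesis using that collapsible_D' collapse_D' by blast
next
  case False
  then obtain x where x: "x \<in> bigons D" and
    ok: "\<And>y. y \<in> bigons D - (face_of D x \<union> face_of D (gl x)) \<Longrightarrow>
      bypass (face_of D x \<union> face_of D (gl x)) f e y \<notin> face_of D y"
    using flattenable_bigon by blast
  define R where "R = face_of D x \<union> face_of D (gl x)"
  interpret r: bigon_removal D R unfolding R_def using x by (rule removal_of_bigon)
  interpret bigon_flattening D F R
  proof
    fix y
    show "glue D y \<in> R" if "y \<in> R"
      using that face_of_gl[of x] face_of_gl[of "gl x"] bigons_flags[OF x] by (auto simp: R_def)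
    show "bypass R f e y \<notin> face_of D y" if "y \<in> bigons D - R" using ok that by (simp add: R_def)
  qed
  have "atomic_operation D D'"
    using x bigons_flags[OF x] cell_decomposition collapsible.cell_decomposition[OF collapsible_D']
    unfolding atomic_operation_def R_def flatten_bigon_eq bigons_def by blast
  moreover have "x \<in> R" by (simp add: R_def)
  then have "flags D' \<subset> flags D" using bigons_flags[OF x] by auto
  then have "card (flags D') < card (flags D)" using finite_flags psubset_card_mono by blast
  ultimately show ?thesis using that collapsible_D' collapse_D' by blast
qed

end

lemma collapsible_collapses:
  assumes "collapsible D F"
  shows "atomic_operation\<^sup>*\<^sup>* D (collapse D F)"
  using assms
proof (induction "card (flags D)" arbitrary: D rule: less_induct)
  case less
  show ?case
  proof (cases "F = flags D")
    case True
    then show ?thesis using collapsible.collapse_all[OF less.prems] by simp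
  next
    case False
    obtain D' where "atomic_operation D D'" "collapsible D' F" "collapse D' F = collapse D F"
      "card (flags D') < card (flags D)"
      using collapsible.atomic_step[OF less.prems False] by blast
    then show ?thesis using less.hyps[of D'] converse_rtranclp_into_rtranclp[of atomic_operation] by metis
  qed
qed

section \<open>Tetrahedra\<close>

lemma transpose_braid:
  fixes p :: "nat \<Rightarrow> 'a"
  shows "p \<circ> transpose 1 2 \<circ> transpose 0 1 \<circ> transpose 1 2 \<circ> transpose 0 1 \<circ> transpose 1 2 \<circ> transpose 0 1 = p"
    and "p \<circ> transpose 2 3 \<circ> transpose 1 2 \<circ> transpose 2 3 \<circ> transpose 1 2 \<circ> transpose 2 3 \<circ> transpose 1 2 = p"
  by (auto simp: fun_eq_iff transpose_def)

context flag_complex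
begin

text \<open>These are the braid relations of adjacent transpositions, transported along
  \<open>\<phi>\<close>: the faces are triangles and the vertices have degree 3.\<close>

lemma tetrahedron_braid:
  assumes "tetrahedron D x" and y: "y \<in> cell_of D x"
  shows "v (e (v (e (v (e y))))) = y" and "e (f (e (f (e (f y))))) = y"
proof -
  let ?P = "\<lambda>p. p permutes {..<4::nat}"
  obtain \<phi> where \<phi>: "bij_betw \<phi> {p. ?P p} (cell_of D x)"
    and v: "\<And>p. ?P p \<Longrightarrow> v (\<phi> p) = \<phi> (p \<circ> transpose 0 1)"
    and e: "\<And>p. ?P p \<Longrightarrow> e (\<phi> p) = \<phi> (p \<circ> transpose 1 2)"
    and f: "\<And>p. ?P p \<Longrightarrow> f (\<phi> p) = \<phi> (p \<circ> transpose 2 3)"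
    using assms(1) unfolding tetrahedron_def by blast
  obtain p where p: "?P p" "y = \<phi> p" using \<phi> y by (auto simp: bij_betw_def)
  have t: "?P (q \<circ> transpose i j)" if "?P q" "i < 4" "j < 4" for q i j
    using that by (intro permutes_compose permutes_swap_id) auto
  \<comment> \<open>Each equation is paired with the admissibility of the new permutation, which
    discharges the condition of the next rewriting.\<close>
  have vp: "v (\<phi> q) = \<phi> (q \<circ> transpose 0 1) \<and> ?P (q \<circ> transpose 0 1)"
    and ep: "e (\<phi> q) = \<phi> (q \<circ> transpose 1 2) \<and> ?P (q \<circ> transpose 1 2)"
    and fp: "f (\<phi> q) = \<phi> (q \<circ> transpose 2 3) \<and> ?P (q \<circ> transpose 2 3)" if "?P q" for q
    using t[OF that] v[OF that] e[OF that] f[OF that] by auto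
  show "v (e (v (e (v (e y))))) = y"
    unfolding p(2) using p(1) transpose_braid(1)[of p] by (simp only: vp ep simp_thms)
  show "e (f (e (f (e (f y))))) = y"
    unfolding p(2) using p(1) transpose_braid(2)[of p] by (simp only: ep fp simp_thms)
qed

lemma tetrahedron_card:
  assumes "tetrahedron D x"
  shows "card (cell_of D x) = 24"
proof -
  obtain \<phi> where "bij_betw \<phi> {p. p permutes {..<4::nat}} (cell_of D x)"
    using assms unfolding tetrahedron_def by blast
  then have "card (cell_of D x) = card {p. p permutes {..<4::nat}}" by (simp add: bij_betw_same_card)
  also have "\<dots> = fact 4" by (rule card_permutations) auto
  finally show ?thesis by (simp add: fact_numeral)
qed

lemma tetrahedron_euler: "x \<in> flags D \<Longrightarrow> tetrahedron D x \<Longrightarrow> euler D x"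
  by (rule euler_24_flags) (auto simp: tetrahedron_card tetrahedron_braid)

text \<open>On a bigon \<open>(v e)^2 = 1\<close>, in a tetrahedron \<open>(v e)^3 = 1\<close>;
  together they would give \<open>v (e x) = x\<close>.\<close>

lemma tetrahedron_not_bigon:
  assumes "tetrahedron D x"
  shows "x \<notin> bigons D"
proof
  assume x: "x \<in> bigons D"
  then have "v (e x) = e (v x)" by (rule bigon_face)
  then have "v (e (v (e x))) = x" by simp
  then have "v (e x) = x" using tetrahedron_braid(1)[OF assms, of x] by simp
  then show False using v_neq_e[of x] bigons_flags[OF x] invol(1) by metis
qed

lemma tetrahedron_cell: "cell_of D y = cell_of D x \<Longrightarrow> tetrahedron D y \<longleftrightarrow> tetrahedron D x"
  by (simp add: tetrahedron_def)

end

section \<open>Crushing\<close>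

locale crushing = flag_complex T for T :: "'f cell_decomp" +
  fixes S :: "'f normal_discs"
  assumes tetra: "x \<in> flags T \<Longrightarrow> tetrahedron T x" and normal: "normal_surface T S"
begin

abbreviation "t \<equiv> triangles S"
abbreviation "q \<equiv> quads S"
abbreviation "w \<equiv> edge_weight T S"
abbreviation "V \<equiv> vertex_of T"
abbreviation "C \<equiv> nondestructive_crush T S"

text \<open>If \<open>x\<close> has edge \<open>ab\<close> and face \<open>abc\<close>, then \<open>q x\<close>, \<open>q1 x\<close>, \<open>q2 x\<close> count the quadrilaterals
  separating \<open>ab\<close>, \<open>ac\<close>, \<open>bc\<close> from their opposite edges.\<close>

definition "q1 x = q (e x)"
definition "q2 x = q (e (v x))"

lemma vevev: "x \<in> flags T \<Longrightarrow> v (e (v (e (v x)))) = e x"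
  using tetrahedron_braid(1)[OF tetra self_in(1), of "e x"] by simp

lemma eve: "x \<in> flags T \<Longrightarrow> e (v (e x)) = v (e (v x))"
  using vevev[of x] invol(1,2) by metis

lemma fef: "x \<in> flags T \<Longrightarrow> f (e (f x)) = e (f (e x))"
  using tetrahedron_braid(2)[OF tetra self_in(1), of x] invol(2,3) by metis

lemma t_e [simp]: "x \<in> flags T \<Longrightarrow> t (e x) = t x" and t_f [simp]: "x \<in> flags T \<Longrightarrow> t (f x) = t x"
  and q_v [simp]: "x \<in> flags T \<Longrightarrow> q (v x) = q x" and q_f [simp]: "x \<in> flags T \<Longrightarrow> q (f x) = q x"
  and q_opposite: "x \<in> flags T \<Longrightarrow> q (opposite_edge T x) = q x"
  and arcs_gl [simp]: "x \<in> flags T \<Longrightarrow> arcs T S (gl x) = arcs T S x"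
  using normal by (simp_all add: normal_surface_def)

lemma q_e [simp]: "q (e x) = q1 x" by (simp add: q1_def)

lemma q1_v [simp]: "q1 (v x) = q2 x" and q2_v [simp]: "q2 (v x) = q1 x" and q1_e [simp]: "q1 (e x) = q x"
  by (simp_all add: q1_def q2_def del: q_e)

lemma q2_e [simp]: "x \<in> flags T \<Longrightarrow> q2 (e x) = q2 x"
  using q_v[of "e (v x)"] by (simp add: q2_def eve del: q_e)

lemma q1_f [simp]: "x \<in> flags T \<Longrightarrow> q1 (f x) = q2 x"
  using q_opposite[of "e (f x)"] vf[of x] by (simp add: q1_def q2_def opposite_edge_def del: q_e)

lemma q2_f [simp]: "x \<in> flags T \<Longrightarrow> q2 (f x) = q1 x"
  using q1_f[of "v x"] by (simp add: vf flip: q1_v)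

lemma t_vev [simp]: "x \<in> flags T \<Longrightarrow> t (v (e (v x))) = t (v (e x))"
  using t_e[of "v (e x)"] by (simp add: eve)

lemma q_exclusive: "x \<in> flags T \<Longrightarrow> q x = 0 \<or> q1 x = 0 \<and> q2 x = 0"
  using normal q_v[of x] by (auto simp: normal_surface_def q1_def q2_def simp del: q_e)

lemma q1_q2: "x \<in> flags T \<Longrightarrow> q1 x = 0 \<or> q2 x = 0"
  using q_exclusive[of "e x"] by auto

lemma arcs_eq: "arcs T S x = t x + q2 x"
  by (simp add: arcs_def q2_def del: q_e)

lemma w_eq: "w x = t x + q2 x + (t (v x) + q1 x)"
  by (simp add: edge_weight_def arcs_eq)

lemma w_v [simp]: "w (v x) = w x"
  by (simp add: w_eq)

lemma w_f [simp]: "x \<in> flags T \<Longrightarrow> w (f x) = w x"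
  by (simp add: w_eq vf)

lemma w_gl [simp]: "x \<in> flags T \<Longrightarrow> w (gl x) = w x"
  using arcs_gl[of x] arcs_gl[of "v x"] by (simp add: edge_weight_def glv)

section \<open>The switches of the crushed decomposition\<close>

definition "FC = {(x, k). x \<in> flags T \<and> k \<le> w x}"

lemma FC_iff [simp]: "(x, k) \<in> FC \<longleftrightarrow> x \<in> flags T \<and> k \<le> w x"
  by (simp add: FC_def)

lemma flags_C [simp]: "flags C = FC"
  by (simp add: nondestructive_crush_def Let_def FC_def)

abbreviation "cv \<equiv> vertex_sw C"
abbreviation "ce \<equiv> edge_sw C"
abbreviation "cf \<equiv> face_sw C"
abbreviation "cg \<equiv> glue C"

lemma C_off: "z \<notin> FC \<Longrightarrow> cv z = z \<and> ce z = z \<and> cf z = z \<and> cg z = z"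
  by (simp add: nondestructive_crush_def Let_def FC_def)

lemma cv: "(x, k) \<in> FC \<Longrightarrow> cv (x, k) = (v x, w x - k)"
  and cf: "(x, k) \<in> FC \<Longrightarrow> cf (x, k) = (f x, k)"
  and cg: "(x, k) \<in> FC \<Longrightarrow> cg (x, k) = (gl x, k)"
  and ce: "(x, k) \<in> FC \<Longrightarrow> ce (x, k) =
    (if k \<le> arcs T S x then (e x, k) else (v (e (v x)), w (e (v x)) - (w x - k)))"
  by (simp_all add: nondestructive_crush_def Let_def FC_def)

lemma cv_in: "z \<in> FC \<Longrightarrow> cv z \<in> FC" and cf_in: "z \<in> FC \<Longrightarrow> cf z \<in> FC"
  by (cases z; simp add: cv cf)+

lemma ce_in:
  assumes "z \<in> FC"
  shows "ce z \<in> FC"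
proof -
  obtain x k where "z = (x, k)" by (cases z)
  then show ?thesis using assms by (auto simp: ce arcs_eq) (auto simp: w_eq)
qed

lemma cv_cv: "cv (cv z) = z" and cf_cf: "cf (cf z) = z" and cg_cg: "cg (cg z) = z"
  by (cases "z \<in> FC"; cases z; simp add: C_off cv cf cg)+

lemma ce_low: "(x, k) \<in> FC \<Longrightarrow> k \<le> t x + q2 x \<Longrightarrow> ce (x, k) = (e x, k)"
  by (simp add: ce arcs_eq)

text \<open>Beyond the central segment, \<open>edge_sw\<close> is the rule for the near corner as
  seen from the other end of the edge, and \<open>cv\<close> changes the end. This reduces the
  second case of the definition to the first.\<close>

lemma ce_high:
  assumes "(x, k) \<in> FC" and "k > t x + q2 x"
  shows "ce (x, k) = cv (ce (cv (x, k)))"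
proof -
  have "ce (cv (x, k)) = (e (v x), w x - k)"
    using assms cv[of x k] by (subst cv) (auto intro!: ce_low simp: w_eq)
  moreover have "w x - k \<le> w (e (v x))" using assms by (simp add: w_eq)
  ultimately show ?thesis using assms by (simp add: ce arcs_eq cv)
qed

lemma ce_ce: "ce (ce z) = z"
proof (cases "z \<in> FC")
  case False
  then show ?thesis by (simp add: C_off)
next
  case True
  obtain x k where z: "z = (x, k)" by (cases z)
  have low: "ce (ce (y, l)) = (y, l)" if "(y, l) \<in> FC" "l \<le> t y + q2 y" for y l
  proof -
    have "(e y, l) \<in> FC" using that by (simp add: w_eq)
    then show ?thesis using that by (simp add: ce_low)
  qed
  show ?thesis
  proof (cases "k \<le> t x + q2 x")
    case True
    then show ?thesis using low \<open>z \<in> FC\<close> z by simp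
  next
    case False
    \<comment> \<open>The inequality is strict because the central segment belongs to the first
      case. Hence \<open>ce z\<close> is again beyond the centre of its edge, and
      \<open>ce_high\<close> applies to it.\<close>
    have lowv: "w x - k < t (v x) + q2 (v x)" using False \<open>z \<in> FC\<close> z by (auto simp: w_eq)
    define u where "u = ce (cv z)"
    have u: "u = (e (v x), w x - k)"
      unfolding u_def z using \<open>z \<in> FC\<close> z lowv by (subst cv) (auto intro!: ce_low)
    have uFC: "u \<in> FC" unfolding u_def using \<open>z \<in> FC\<close> by (simp add: cv_in ce_in)
    have cz: "ce z = cv u" unfolding u_def z by (rule ce_high) (use False \<open>z \<in> FC\<close> z in auto)
    have "cv u = (v (e (v x)), w (e (v x)) - (w x - k))" using uFC u by (simp add: cv)
    moreover have "w (e (v x)) - (w x - k) > t (v (e (v x))) + q2 (v (e (v x)))"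
      using lowv uFC u \<open>z \<in> FC\<close> z by (simp add: w_eq)
    ultimately have "ce (cv u) = cv (ce u)"
      using ce_high[of "v (e (v x))" "w (e (v x)) - (w x - k)"] cv_in[OF uFC] cv_cv[of u] by simp
    also have "ce u = cv z"
      unfolding u_def using low[of "v x" "w x - k"] lowv \<open>z \<in> FC\<close> z by (simp add: cv)
    finally show ?thesis using cz by (simp add: cv_cv)
  qed
qed

text \<open>The vertices of the crushed decomposition: a copy of a triangle seen from the vertex it
  surrounds (\<open>0\<close>) or from the far side (\<open>1\<close>), or one side of a quadrilateral, which is given by the two
  vertices of the tetrahedron on that side (\<open>2\<close>).\<close>

definition side :: "'f \<Rightarrow> 'f set set" where
  "side x = {V x, V (v (if q1 x > 0 then e x else e (f x)))}"

definition label :: "'f \<times> nat \<Rightarrow> nat \<times> 'f set set \<times> nat" where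
  "label z = (case z of (x, k) \<Rightarrow>
     if k \<le> t x then (0, {V x}, k)
     else if w x - k < t (v x) then (1, {V (v x)}, w x - k)
     else (2, side x, k - t x))"

lemma V_v_neq:
  assumes "x \<in> flags T"
  shows "V (v x) \<noteq> V x"
  using assms vertex_Int_face[of x "v x"] face_step[of x x] v_neq[of x] v_neq_e[of x] self_in(2,4) by metis

lemma V_ve_neq:
  assumes x: "x \<in> flags T"
  shows "V (v (e x)) \<noteq> V (v x)"
proof -
  have "V (v (e x)) = V (v (e (v x)))" using eve[OF x] vertex_of_e by metis
  then show ?thesis using V_v_neq[of "e (v x)"] x by simp
qed

lemma V_vf [simp]: "x \<in> flags T \<Longrightarrow> V (v (f x)) = V (v x)"
  by (simp add: vf)

lemma V_v_notin_side:
  assumes x: "x \<in> flags T"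
  shows "V (v x) \<notin> side x"
  using V_v_neq[OF x] V_ve_neq[OF x] V_ve_neq[of "f x"] x by (auto simp: side_def)

lemma label_v:
  assumes "z \<in> FC"
  shows "label (cv z) \<noteq> label z"
proof -
  obtain x k where z: "z = (x, k)" by (cases z)
  \<comment> \<open>These facts separate the two ends of a segment when both labels are of the same
    kind.\<close>
  have "V (v x) \<noteq> V x" "V (v x) \<notin> side x" "V (v x) \<in> side (v x)"
    using assms z V_v_neq V_v_notin_side by (auto simp: side_def)
  then show ?thesis using assms z by (auto simp: cv label_def)
qed

lemma label_f:
  assumes "z \<in> FC"
  shows "label (cf z) = label z"
proof -
  obtain x k where z: "z = (x, k)" by (cases z)
  have x: "x \<in> flags T" using assms z by simp
  \<comment> \<open>If no quadrilateral meets the edge, \<open>side\<close> depends on the chosen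
    face. Labels of kind 2 arise only when one does.\<close>
  have "side (f x) = side x" if "q1 x + q2 x > 0"
    using that q1_q2[OF x] x by (auto simp: side_def)
  moreover have "q1 x + q2 x > 0" if "\<not> k \<le> t x" "\<not> w x - k < t (v x)"
    using that assms z by (auto simp: w_eq)
  ultimately show ?thesis using assms z x by (auto simp: cf label_def vf)
qed

lemma label_e:
  assumes "z \<in> FC"
  shows "label (ce z) = label z"
proof -
  obtain x k where z: "z = (x, k)" by (cases z)
  have x: "x \<in> flags T" "k \<le> w x" using assms z by simp_all
  show ?thesis
  proof (cases "k \<le> t x + q2 x")
    case True
    then have c: "ce z = (e x, k)" using assms z ce_low by simp
    show ?thesis
    proof (cases "k \<le> t x")
      case True
      then show ?thesis using c z x by (simp add: label_def)
    next
      case False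
      then have q: "q x = 0" "q1 x = 0" using True q_exclusive[OF x(1)] q1_q2[OF x(1)] by auto
      \<comment> \<open>Both terms name the fourth vertex of the tetrahedron, reached through
        different faces.\<close>
      have "V (v (e (f (e x)))) = V (v (e (f x)))"
        using fef[OF x(1)] x V_vf[of "e (f x)"] by simp
      then have "side (e x) = side x" using q by (simp add: side_def)
      moreover have "\<not> w (e x) - k < t (v (e x))" "\<not> w x - k < t (v x)"
        using True q x by (auto simp: w_eq)
      ultimately show ?thesis using c z x False by (simp add: label_def)
    qed
  next
    case False
    \<comment> \<open>Counted from the far end of the edge, the segment and its image under
      \<open>edge_sw\<close> have the same number \<open>j\<close>.\<close>
    define j where "j = w x - k"
    have j: "j < t (v x) + q1 x" "k = w x - j" "j \<le> w x" using False x by (auto simp: j_def w_eq)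
    have c: "ce z = (v (e (v x)), w (e (v x)) - j)"
      using False assms z by (simp add: ce arcs_eq j_def)
    have wj: "w (e (v x)) = t (v x) + q1 x + (t (v (e x)) + q x)" using x by (simp add: w_eq)
    have "\<not> w (e (v x)) - j \<le> t (v (e x))" "w (e (v x)) - (w (e (v x)) - j) = j"
      using wj j(1) by auto
    then have lc: "label (ce z) = (if j < t (v x) then (1, {V (v x)}, j)
        else (2, side (v (e (v x))), w (e (v x)) - j - t (v (e x))))"
      using x unfolding c by (simp add: label_def)
    have lz: "label z = (if j < t (v x) then (1, {V (v x)}, j) else (2, side x, k - t x))"
      using False unfolding z j_def by (simp add: label_def)
    show ?thesis
    proof (cases "j < t (v x)")
      case True
      then show ?thesis using lc lz by simp
    next
      case nj: False
      then have q: "q1 x > 0" "q x = 0" "q2 x = 0"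
        using j(1) q_exclusive[OF x(1)] q1_q2[OF x(1)] by auto
      have "V (v (e (v x))) = V (v (e x))" using eve[OF x(1)] vertex_of_e by metis
      moreover have "V (v (e (v (e (v x))))) = V x" using vevev[OF x(1)] by simp
      ultimately have "side (v (e (v x))) = side x" using q x by (auto simp: side_def)
      moreover have "w x = t x + (t (v x) + q1 x)" using q by (simp add: w_eq)
      then have "w (e (v x)) - j - t (v (e x)) = k - t x" using wj j q by simp
      ultimately show ?thesis using lc lz nj by simp
    qed
  qed
qed

text \<open>The flag of the central segment, which is a side of the central triangle of the 2-face.
  By \<open>mid_if\<close> all other flags lie in bigons.\<close>

abbreviation "mid x \<equiv> (x, t x + q2 x)"

lemma mid_in: "x \<in> flags T \<Longrightarrow> mid x \<in> FC"
  by (simp add: w_eq)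

lemma cv_mid: "x \<in> flags T \<Longrightarrow> cv (mid x) = mid (v x)" and ce_mid: "x \<in> flags T \<Longrightarrow> ce (mid x) = mid (e x)"
  by (simp_all add: cv ce_low w_eq)

text \<open>Off the centre exactly one of \<open>z\<close> and \<open>cv z\<close> falls under
  \<open>ce_high\<close>, and conjugation by the involution \<open>cv\<close> becomes
  commutation.\<close>

lemma commute_off_mid:
  assumes "z \<in> FC" and "\<And>x. z \<noteq> mid x"
  shows "cv (ce z) = ce (cv z)"
proof -
  obtain x k where z: "z = (x, k)" by (cases z)
  have k: "k \<noteq> t x + q2 x" using assms(2)[of x] z by auto
  show ?thesis
  proof (cases "k > t x + q2 x")
    case True
    then show ?thesis using ce_high[of x k] assms(1) z by (simp add: cv_cv)
  next
    case False
    then have "ce (v x, w x - k) = cv (ce (cv (v x, w x - k)))"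
      using assms(1) k z by (intro ce_high) (auto simp: w_eq)
    moreover have "cv z = (v x, w x - k)" using z assms(1) by (simp add: cv)
    ultimately show ?thesis using cv_cv[of z] by simp
  qed
qed

lemma ce_cg: "z \<in> FC \<Longrightarrow> cg (ce z) = ce (cg z)"
  and cv_cg: "z \<in> FC \<Longrightarrow> cg (cv z) = cv (cg z)"
proof -
  have cvg: "cg (cv z) = cv (cg z)" if "z \<in> FC" for z
  proof -
    obtain x k where z: "z = (x, k)" by (cases z)
    then show ?thesis using that by (simp add: cv cg glv)
  qed
  then show "z \<in> FC \<Longrightarrow> cg (cv z) = cv (cg z)" .
  have q: "t (gl x) + q2 (gl x) = t x + q2 x" if "x \<in> flags T" for x
    using arcs_gl[OF that] by (simp add: arcs_eq)
  have low: "cg (ce (x, k)) = ce (cg (x, k))" if "(x, k) \<in> FC" "k \<le> t x + q2 x" for x k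
  proof -
    have "(e x, k) \<in> FC" using that by (simp add: w_eq)
    then show ?thesis using that q by (simp add: ce_low cg gle)
  qed
  assume zF: "z \<in> FC"
  obtain x k where z: "z = (x, k)" by (cases z)
  show "cg (ce z) = ce (cg z)"
  proof (cases "k \<le> t x + q2 x")
    case True
    then show ?thesis using low zF z by simp
  next
    case False
    have "ce z = cv (ce (cv z))" using ce_high[of x k] False zF z by simp
    moreover have "ce (cg z) = cv (ce (cv (cg z)))"
      using ce_high[of "gl x" k] False zF z q by (simp add: cg)
    moreover have "cg (ce (cv z)) = ce (cg (cv z))"
      using low[of "v x" "w x - k"] False zF z by (simp add: cv w_eq)
    ultimately show ?thesis using cvg zF cv_in ce_in by simp
  qed
qed

text \<open>The first part pulls conditions on faces back to \<open>T\<close>. The second gives the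
  corner condition, labels being constant on vertices (\<open>label_vertex\<close>): up to
  \<open>ce\<close>, every other flag of the face is one \<open>cv\<close> away from
  \<open>z\<close> or \<open>ce z\<close>, and \<open>cv\<close> changes the label.\<close>

lemma face_C:
  assumes "z \<in> FC" and "y \<in> face_of C z"
  shows "fst y \<in> face_of T (fst z)" and "y = z \<or> y = ce z \<or> label y \<noteq> label z"
proof -
  have "face_of C z \<subseteq> {y \<in> FC. fst y \<in> face_of T (fst z)}"
    unfolding face_of_def[of C]
  proof (rule flag_orbit_subset)
    fix y h assume y: "y \<in> {y \<in> FC. fst y \<in> face_of T (fst z)}" and h: "h \<in> {cv, ce}"
    obtain x k where "y = (x, k)" by (cases y)
    then show "h y \<in> {y \<in> FC. fst y \<in> face_of T (fst z)}"
      using y h cv_in[of y] ce_in[of y] face_step by (auto simp: cv ce)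
  qed (use assms in simp)
  then show "fst y \<in> face_of T (fst z)" using assms by blast
  note l = label_v label_e cv_in ce_in
  show "y = z \<or> y = ce z \<or> label y \<noteq> label z"
  proof (cases "\<exists>x. z = mid x")
    case False
    then have "cv (ce z) = ce (cv z)" using commute_off_mid assms(1) by blast
    moreover then have "cv (ce (cv z)) = ce z" by (metis cv_cv)
    ultimately have "face_of C z \<subseteq> {z, ce z, cv z, ce (cv z)}"
      unfolding face_of_def by (intro flag_orbit_subset) (auto simp: cv_cv ce_ce)
    moreover have "label (ce (cv z)) \<noteq> label z" "label (cv z) \<noteq> label z"
      using l assms(1) by metis+
    ultimately show ?thesis using assms(2) by blast
  next
    case True
    then obtain x where z: "z = mid x" by blast
    have x: "x \<in> flags T" using assms(1) z by simp
    have "face_of C z \<subseteq> {mid x, mid (e x), mid (v x), mid (e (v x)), mid (v (e x)), mid (v (e (v x)))}"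
      unfolding face_of_def
    proof (rule flag_orbit_subset)
      fix y h
      assume "y \<in> {mid x, mid (e x), mid (v x), mid (e (v x)), mid (v (e x)), mid (v (e (v x)))}" "h \<in> {cv, ce}"
      moreover have "e (v (e (v x))) = v (e x)" using eve[OF x] invol(2) by metis
      ultimately show "h y \<in> {mid x, mid (e x), mid (v x), mid (e (v x)), mid (v (e x)), mid (v (e (v x)))}"
        using x eve[OF x] by (elim insertE emptyE; simp only: cv_mid ce_mid in_flags invol) auto
    qed (simp add: z)
    moreover have m: "mid (e x) = ce z" "mid (v x) = cv z" "mid (e (v x)) = ce (cv z)"
      "mid (v (e x)) = cv (ce z)" "mid (v (e (v x))) = ce (cv (ce z))"
      using x eve[OF x] by (simp_all only: z cv_mid ce_mid in_flags)
    moreover have "label (cv (ce z)) \<noteq> label z" "label (ce (cv (ce z))) \<noteq> label z"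
      "label (ce (cv z)) \<noteq> label z" "label (cv z) \<noteq> label z"
      using l assms(1) by metis+
    ultimately show ?thesis using assms(2) unfolding m z[symmetric] by blast
  qed
qed

lemma label_vertex:
  assumes "z \<in> FC" and "y \<in> vertex_of C z"
  shows "label y = label z"
proof -
  have "vertex_of C z \<subseteq> {y \<in> FC. label y = label z}"
    unfolding vertex_of_def by (rule flag_orbit_subset) (use assms label_e label_f ce_in cf_in in auto)
  then show ?thesis using assms by blast
qed

lemma flag_complex_C: "flag_complex C"
proof
  have "FC \<subseteq> (SIGMA x:flags T. {..w x})" by auto
  then show "finite (flags C)" using finite_flags finite_subset by fastforce
next
  fix h assume h: "h \<in> {cv, ce, cf, cg}"
  then have inv: "\<forall>z. h (h z) = z" using cv_cv ce_ce cf_cf cg_cg by auto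
  have off: "h z = z" if "z \<notin> FC" for z using h C_off[OF that] by auto
  have "h permutes FC"
    unfolding permutes_def using inv off by metis
  then show "h permutes flags C \<and> (\<forall>z. h (h z) = z)" using inv by simp
next
  fix z assume "z \<in> flags C"
  then have z: "z \<in> FC" by simp
  obtain x k where xk: "z = (x, k)" by (cases z)
  have x: "x \<in> flags T" using z xk by simp
  have "cv z \<noteq> z" using label_v[OF z] by auto
  moreover have "ce z \<noteq> z"
  proof (cases "k \<le> t x + q2 x")
    case True
    then show ?thesis using z xk e_neq[OF x] by (simp add: ce_low)
  next
    case False
    have "ce (cv z) = (e (v x), w x - k)"
      using False z xk by (simp add: cv ce_low w_eq)
    moreover have "cv z = (v x, w x - k)" using z xk by (simp add: cv)
    ultimately have "ce (cv z) \<noteq> cv z" using e_neq[of "v x"] x by simp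
    then show ?thesis using ce_high[of x k] False z xk cv_cv[of "ce (cv z)"] by auto
  qed
  moreover have "cv z \<noteq> ce z" using label_v[OF z] label_e[OF z] by auto
  moreover have "cv (cf z) = cf (cv z)" using z xk by (simp add: cv cf vf)
  moreover have "cf z \<notin> face_of C z"
    using face_C(1)[OF z, of "cf z"] f_notin_face[OF x] z xk by (auto simp: cf)
  moreover have "vertex_of C z \<inter> face_of C z \<subseteq> {z, ce z}"
    using face_C(2)[OF z] label_vertex[OF z] by blast
  moreover have "cg z \<noteq> z \<longrightarrow> cg z \<notin> face_of C z"
    using face_C(1)[OF z, of "cg z"] gl_notin_face[OF x] z xk by (auto simp: cg)
  ultimately show "cv z \<noteq> z \<and> ce z \<noteq> z \<and> cv z \<noteq> ce z \<and> cv (cf z) = cf (cv z) \<and>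
        cf z \<notin> face_of C z \<and> vertex_of C z \<inter> face_of C z \<subseteq> {z, ce z} \<and>
        cg (cv z) = cv (cg z) \<and> cg (ce z) = ce (cg z) \<and> (cg z \<noteq> z \<longrightarrow> cg z \<notin> face_of C z)"
    using cv_cg[OF z] ce_cg[OF z] by blast
qed

section \<open>Triangles, tetrahedra and purses of the crushed decomposition\<close>

sublocale C: flag_complex C
  by (rule flag_complex_C)

lemma mid_if: "z \<in> FC \<Longrightarrow> z \<notin> bigons C \<Longrightarrow> \<exists>x \<in> flags T. z = mid x"
  using C.bigon_intro[of z] commute_off_mid[of z] by fastforce

lemma mid_triangle:
  assumes x: "x \<in> flags T"
  shows "polygon C 3 (mid x)"
proof -
  have "v (e (v (e (v (e x))))) = x" using vevev[of "e x"] x by simp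
  then have "cv (ce (cv (ce (cv (ce (mid x)))))) = mid x" using x by (simp only: cv_mid ce_mid in_flags)
  then show ?thesis using C.triangle_intro mid_in[OF x] by simp
qed

lemma mid_not_bigon: "x \<in> flags T \<Longrightarrow> mid x \<notin> bigons C"
  using mid_triangle[of x] by (simp add: bigons_def polygon_def)

text \<open>Without quadrilaterals the central segment has the same number in both faces at an edge,
  so \<open>mid\<close> commutes with all switches and copies the tetrahedron of
  \<open>T\<close>.\<close>

lemma tetrahedron_mid:
  assumes x: "x \<in> flags T" and "q x = 0" "q1 x = 0" "q2 x = 0"
  shows "tetrahedron C (mid x)"
proof -
  let ?N = "{y \<in> flags T. q y = 0 \<and> q1 y = 0 \<and> q2 y = 0}"
  have N: "cell_of T x \<subseteq> ?N" by (rule cell_of_minimal) (use assms in auto)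
  have cf_mid: "cf (mid y) = mid (f y)" if "y \<in> cell_of T x" for y
    using that N mid_in[of y] by (auto simp: cf)
  have inT: "y \<in> flags T" if "y \<in> cell_of T x" for y using that N by blast
  have "cell_of C (mid x) = mid ` cell_of T x"
  proof
    show "cell_of C (mid x) \<subseteq> mid ` cell_of T x"
    proof (rule C.cell_of_minimal)
      fix z assume "z \<in> mid ` cell_of T x"
      then obtain y where y: "y \<in> cell_of T x" "z = mid y" by blast
      then show "cv z \<in> mid ` cell_of T x \<and> ce z \<in> mid ` cell_of T x \<and> cf z \<in> mid ` cell_of T x"
        using cv_mid[OF inT] ce_mid[OF inT] cf_mid cell_step[of y x] by (metis (no_types, lifting) imageI)
    qed simp
    have "cell_of T x \<subseteq> {y \<in> cell_of T x. mid y \<in> cell_of C (mid x)}"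
    proof (rule cell_of_minimal)
      fix y assume y: "y \<in> {y \<in> cell_of T x. mid y \<in> cell_of C (mid x)}"
      then have "cv (mid y) \<in> cell_of C (mid x)" "ce (mid y) \<in> cell_of C (mid x)" "cf (mid y) \<in> cell_of C (mid x)"
        using C.cell_step by blast+
      then show "v y \<in> {y \<in> cell_of T x. mid y \<in> cell_of C (mid x)} \<and>
          e y \<in> {y \<in> cell_of T x. mid y \<in> cell_of C (mid x)} \<and>
          f y \<in> {y \<in> cell_of T x. mid y \<in> cell_of C (mid x)}"
        using y cell_step[of y x] inT[of y] cf_mid[of y] cv_mid[of y] ce_mid[of y] by simp
    qed simp
    then show "mid ` cell_of T x \<subseteq> cell_of C (mid x)" by blast
  qed
  then have cell: "cell_of C (mid x) = mid ` cell_of T x" .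
  obtain \<phi> where \<phi>: "bij_betw \<phi> {p. p permutes {..<4::nat}} (cell_of T x)"
    "\<And>p. p permutes {..<4} \<Longrightarrow> v (\<phi> p) = \<phi> (p \<circ> transpose 0 1)"
    "\<And>p. p permutes {..<4} \<Longrightarrow> e (\<phi> p) = \<phi> (p \<circ> transpose 1 2)"
    "\<And>p. p permutes {..<4} \<Longrightarrow> f (\<phi> p) = \<phi> (p \<circ> transpose 2 3)"
    using tetra[OF x] unfolding tetrahedron_def by blast
  have \<phi>_in: "\<phi> p \<in> cell_of T x" if "p permutes {..<4}" for p
    using that \<phi>(1) by (auto simp: bij_betw_def)
  have "bij_betw mid (cell_of T x) (mid ` cell_of T x)"
    by (simp add: bij_betw_def inj_on_def)
  then have bij: "bij_betw (mid \<circ> \<phi>) {p. p permutes {..<4::nat}} (mid ` cell_of T x)"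
    using \<phi>(1) bij_betw_trans by blast
  have "cv (mid (\<phi> p)) = mid (\<phi> (p \<circ> transpose 0 1)) \<and> ce (mid (\<phi> p)) = mid (\<phi> (p \<circ> transpose 1 2)) \<and>
      cf (mid (\<phi> p)) = mid (\<phi> (p \<circ> transpose 2 3))" if p: "p permutes {..<4}" for p
    unfolding cv_mid[OF inT[OF \<phi>_in[OF p]]] ce_mid[OF inT[OF \<phi>_in[OF p]]] cf_mid[OF \<phi>_in[OF p]]
      \<phi>(2)[OF p] \<phi>(3)[OF p] \<phi>(4)[OF p] by blast
  then show ?thesis
    unfolding tetrahedron_def cell using bij by (intro exI[of _ "mid \<circ> \<phi>"] conjI) (simp_all only: o_apply, blast)
qed

text \<open>Flattening a purse moves the vertex \<open>d\<close> opposite to its triangle \<open>abc\<close> to the vertex of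
  \<open>abc\<close> which the quadrilaterals separate from the two others.\<close>

definition opp :: "'f \<Rightarrow> 'f" where
  "opp x = (if q x > 0 then f x else if q1 x > 0 then e (f (e x)) else v (e (f (e (v x)))))"

lemma opp_in: "x \<in> flags T \<Longrightarrow> opp x \<in> flags T"
  by (simp add: opp_def)

lemma across_mid:
  assumes x: "x \<in> flags T" and pos: "q x > 0 \<or> q1 x > 0 \<or> q2 x > 0"
  shows "across C (mid x) = mid (opp x)"
proof -
  have fx: "f x \<in> flags T" using x by simp
  have cfm: "cf (mid x) = (f x, t x + q2 x)" using mid_in[OF x] by (simp add: cf)
  \<comment> \<open>If the central segments of the two faces at the edge have different numbers,
    \<open>cf\<close> leads into a bigon; here a single crossing of it suffices.\<close>
  have chain: "across C (mid x) = cf (ce (f x, t x + q2 x))"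
    if "q1 x \<noteq> q2 x" "cf (ce (f x, t x + q2 x)) \<notin> bigons C"
  proof -
    have "(f x, t x + q2 x) \<in> FC" using mid_in[OF x] x by simp
    moreover have "(f x, t x + q2 x) \<noteq> mid y" for y using that x by auto
    ultimately have "(f x, t x + q2 x) \<in> bigons C"
      using C.bigon_intro[OF _ commute_off_mid] flags_C by blast
    then show ?thesis
      using that(2) cfm by (simp add: bypass_exit exit_into leaves.out)
  qed
  \<comment> \<open>The quadrilaterals miss the edge, or they meet the 2-face in arcs around the far
    or the near end of the edge.\<close>
  consider "q x > 0" "q1 x = 0" "q2 x = 0" | "q x = 0" "q1 x > 0" "q2 x = 0" | "q x = 0" "q1 x = 0" "q2 x > 0"
    using pos q_exclusive[OF x] q1_q2[OF x] by auto
  then show ?thesis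
  proof cases
    case 1
    then have "cf (mid x) = mid (opp x)" using cfm x by (simp add: opp_def)
    then show ?thesis using mid_not_bigon[OF opp_in[OF x]] by (simp add: bypass_exit)
  next
    case 2
    have "cf (ce (f x, t x + q2 x)) = (f (e (f x)), t x)"
      using x 2 mid_in[OF fx] by (simp add: ce_low cf w_eq)
    also have "\<dots> = mid (opp x)"
      using 2 x by (simp add: opp_def fef)
    finally have m: "cf (ce (f x, t x + q2 x)) = mid (opp x)" .
    then show ?thesis using chain 2 mid_not_bigon[OF opp_in[OF x]] by simp
  next
    case 3
    let ?y = "v (e (f (v x)))"
    have wx: "w x = t x + q2 x + t (v x)" using 3 by (simp add: w_eq)
    have wy: "w (e (f (v x))) = t (v x) + q2 x + t ?y" using 3 x by (simp add: w_eq)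
    \<comment> \<open>In the neighbouring face the quadrilaterals cut off the other end of the edge,
      so the segment is now beyond the centre and \<open>edge_sw\<close> counts from the far
      end.\<close>
    have "ce (f x, t x + q2 x) = (?y, q2 x + t ?y)"
      using 3 x wx wy by (subst ce) (simp_all add: arcs_eq vf)
    moreover have "(?y, q2 x + t ?y) \<in> FC" using 3 x wy by simp
    ultimately have "cf (ce (f x, t x + q2 x)) = (f ?y, q2 x + t ?y)" by (simp add: cf)
    also have f: "f ?y = v (e (f (e (v x))))" using x fef[of "v x"] by (simp flip: vf)
    also have "(v (e (f (e (v x)))), q2 x + t ?y) = mid (opp x)"
    proof -
      have "t (v (e (f (e (v x))))) = t ?y" using f x t_f[of ?y] by simp
      moreover have "q2 (v (e (f (e (v x))))) = q2 x" using x by simp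
      ultimately show ?thesis using 3 by (simp add: opp_def)
    qed
    finally have "cf (ce (f x, t x + q2 x)) = mid (opp x)" .
    then show ?thesis using chain 3 mid_not_bigon[OF opp_in[OF x]] by simp
  qed
qed

lemma opp_notin_face:
  assumes x: "x \<in> flags T"
  shows "opp x \<notin> face_of T x"
proof -
  have "e (f (e x)) \<notin> face_of T x"
    using face_step(2)[of "e (f (e x))" x] f_notin_face[of "e x"] x by auto
  moreover have "v (e (f (e (v x)))) \<notin> face_of T x"
    using face_step(1)[of "v (e (f (e (v x))))" x] face_step(2)[of "e (f (e (v x)))" x]
      f_notin_face[of "e (v x)"] x by auto
  ultimately show ?thesis using f_notin_face[OF x] by (simp add: opp_def)
qed

lemma opp_e:
  assumes x: "x \<in> flags T" and pos: "q x > 0 \<or> q1 x > 0 \<or> q2 x > 0"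
  shows "opp (e x) = e (opp x)"
proof -
  have "v (e (f (e (v (e x))))) = e (v (e (f (e (v x)))))"
  proof -
    have "v (e (f (e (v (e x))))) = v (e (v (f (e (v x)))))" using eve[OF x] vf[of "e (v x)"] x by simp
    also have "\<dots> = e (v (e (f (e (v x)))))" using eve[of "f (e (v x))"] x by simp
    finally show ?thesis .
  qed
  then show ?thesis using x pos q_exclusive[OF x] q1_q2[OF x] by (auto simp: opp_def)
qed

lemma collapsible_C: "collapsible C {z \<in> flags C. tetrahedron C z}"
proof (intro collapsible.intro collapsible_axioms.intro)
  show "flag_complex C" by (rule flag_complex_C)
  show "{z \<in> flags C. tetrahedron C z} \<subseteq> flags C" by blast
next
  fix z assume "z \<in> {z \<in> flags C. tetrahedron C z}"
  then have z: "z \<in> flags C" "tetrahedron C z" by blast+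
  then show "cv z \<in> {z \<in> flags C. tetrahedron C z} \<and> ce z \<in> {z \<in> flags C. tetrahedron C z} \<and>
      cf z \<in> {z \<in> flags C. tetrahedron C z}"
    using C.tetrahedron_cell[of "cv z" z] C.tetrahedron_cell[of "ce z" z] C.tetrahedron_cell[of "cf z" z]
      C.in_flags(1-3)[of z] C.cell_of_v[of z] C.cell_of_e[of z] C.cell_of_f[of z] by blast
  show "z \<notin> bigons C" using z(2) by (rule C.tetrahedron_not_bigon)
  show "euler C z" using z by (rule C.tetrahedron_euler)
next
  fix z assume z: "z \<in> flags C - {z \<in> flags C. tetrahedron C z} - bigons C"
  then obtain x where x: "x \<in> flags T" and zx: "z = mid x" using mid_if[of z] by auto
  have "\<not> tetrahedron C (mid x)" using z zx by blast
  \<comment> \<open>A triangle outside the tetrahedral cells comes from a tetrahedron of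
    \<open>T\<close> that contains quadrilaterals.\<close>
  then have pos: "q x > 0 \<or> q1 x > 0 \<or> q2 x > 0"
    using tetrahedron_mid[OF x] by blast
  have "across C (ce z) = ce (across C z)"
    using across_mid[OF x pos] across_mid[of "e x"] opp_e[OF x pos] pos x zx
      ce_mid[OF x] ce_mid[OF opp_in[OF x]] by auto
  moreover have "across C z \<notin> face_of C z"
    using face_C(1)[OF mid_in[OF x], of "mid (opp x)"] opp_notin_face[OF x] across_mid[OF x pos] zx by auto
  ultimately show "polygon C 3 z \<and> across C z \<notin> face_of C z \<and> across C (ce z) = ce (across C z)"
    using mid_triangle[OF x] zx by simp
qed

end

theorem lemma3:
  fixes T :: "'f cell_decomp" and S :: "'f normal_discs"
  assumes "generalised_triangulation T"
    and "normal_surface T S"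
  shows "atomic_operation\<^sup>*\<^sup>* (nondestructive_crush T S) (destructive_crush T S)"
proof -
  interpret flag_complex T
    using assms(1) unfolding generalised_triangulation_def cell_decomposition_iff by blast
  interpret crushing T S
    by unfold_locales (use assms in \<open>auto simp: generalised_triangulation_def\<close>)
  show ?thesis
    using collapsible_collapses[OF collapsible_C]
    by (simp add: destructive_crush_def flatten_non_tetrahedra_eq)
qed

end
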